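(* Let $n\ge3$. Assume $\gamma<\frac{n^2}{4}$ and let $u\in C^2(\overline{\mathbb{R}^n_+}\setminus\{0\})$ be such that $$\begin{cases}-\Delta u-\frac{\gamma}{|x|^2}u=0&\text{in }\mathbb{R}^n_+\\ u>0&\text{in }\mathbb{R}^n_+\\ u=0&\text{on }\partial\mathbb{R}^n_+\setminus\{0\}.\end{cases}$$ Then there exist $\lambda_-,\lambda_+\ge0$ such that $$u(x)=\lambda_-x_1|x|^{-\alpha_-(\gamma)}+\lambda_+x_1|x|^{-\alpha_+(\gamma)}\quad\text{for all }x\in\mathbb{R}^n_+.$$
   Context: $\mathbb{R}^n_+=\{x\in\mathbb{R}^n:\ x_1>0\}$ and $\alpha_\pm(\gamma):=\frac n2\pm\sqrt{\frac{n^2}{4}-\gamma}$. *)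

theory Defs
  imports "HOL-Analysis.Analysis"
begin

text \<open>
  Points of $n$-space are vectors of type \<open>real ^ 'n\<close> with $n$ = \<open>CARD('n)\<close>. The index type carries no
  order, so an arbitrary index \<open>k\<close> plays the role of the first coordinate.
\<close>

definition half_space :: "'n::finite \<Rightarrow> (real ^ 'n) set" where
  "half_space k = {x. x $ k > 0}"

definition alpha_plus :: "nat \<Rightarrow> real \<Rightarrow> real" where
  "alpha_plus n \<gamma> = real n / 2 + sqrt ((real n)\<^sup>2 / 4 - \<gamma>)"

definition alpha_minus :: "nat \<Rightarrow> real \<Rightarrow> real" where
  "alpha_minus n \<gamma> = real n / 2 - sqrt ((real n)\<^sup>2 / 4 - \<gamma>)"

definition partial_deriv :: "'n::finite \<Rightarrow> (real ^ 'n \<Rightarrow> real) \<Rightarrow> real ^ 'n \<Rightarrow> real" where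
  "partial_deriv i f x = deriv (\<lambda>t. f (x + t *\<^sub>R axis i 1)) 0"

definition laplacian :: "(real ^ 'n::finite \<Rightarrow> real) \<Rightarrow> real ^ 'n \<Rightarrow> real" where
  "laplacian f x = (\<Sum>i\<in>UNIV. partial_deriv i (partial_deriv i f) x)"

text \<open>
  For \<open>\<Omega>\<close> open and \<open>\<Omega> \<subseteq> D \<subseteq> closure \<Omega>\<close>, \<open>Ck_up_to m \<Omega> D f\<close> says that \<open>f\<close> is of class $C^m$ in \<open>\<Omega>\<close>
  and that \<open>f\<close> and all its partial derivatives of order at most \<open>m\<close> extend continuously from \<open>\<Omega>\<close>
  to \<open>D\<close>, the extension of \<open>f\<close> being \<open>f\<close> itself. The values of \<open>f\<close> outside \<open>D\<close> are irrelevant.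
  In the recursive clause \<open>g\<close> is the extension to \<open>D\<close> of the \<open>i\<close>-th partial derivative.
\<close>

primrec Ck_up_to ::
  "nat \<Rightarrow> (real ^ 'n::finite) set \<Rightarrow> (real ^ 'n) set \<Rightarrow> (real ^ 'n \<Rightarrow> real) \<Rightarrow> bool" where
  "Ck_up_to 0 \<Omega> D f \<longleftrightarrow> continuous_on D f"
| "Ck_up_to (Suc m) \<Omega> D f \<longleftrightarrow> continuous_on D f \<and>
     (\<forall>i. (\<forall>x\<in>\<Omega>. (\<lambda>t. f (x + t *\<^sub>R axis i 1)) field_differentiable at 0) \<and>
          (\<exists>g. Ck_up_to m \<Omega> D g \<and> (\<forall>x\<in>\<Omega>. g x = partial_deriv i f x)))"

end

theory Submission
  imports Defs
begin

text \<open>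
  Put $t = \ln |x|$. In the variables $t$ and $\sigma = x / |x|$ the equation is invariant under translations of $t$, and
  expanding $u$ into Dirichlet eigenfunctions of the half-sphere decouples it: the coefficient of a mode of
  degree $d + 1$ is a combination of $e^{-(n-2)t/2} e^{\pm a_d t}$, where $a_d^2 = (d + n/2)^2 - \gamma$. The
  lowest eigenfunction $\sigma_k$ is positive, and each of the others is bounded by a multiple of it. Since
  $u$ is positive, each coefficient is therefore bounded by a multiple of the lowest one, which involves only
  $e^{\pm a_0 t}$; because $a_d > a_0$ for $d \ge 1$, no higher mode can be present. So $u = x_k F(|x|)$, and the radial equation for $F$ has the two
  powers of the conclusion as its solutions. Positivity of $u$ as $t \to \pm\infty$ gives the signs of the
  coefficients.

  The proof below carries this out with neither spherical harmonics nor integration over spheres.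
  Eigenfunctions are replaced by the functions $x_k (a \cdot x)^d$ with $a$ orthogonal to $e_k$, and spherical
  integrals by averages over annuli, smooth in the logarithm of their radius (\<open>moment\<close>). Green's
  identity (\<open>weak_formulation\<close>) yields a triangular system of ordinary differential equations for these
  moments (\<open>moment_identity\<close>), and the growth argument shows that all of them are universal multiples of
  the lowest one (\<open>moment_proportional\<close>). So if $u$ and $v$ are positive solutions, then on each annulus
  some combination $u - \kappa v$ is orthogonal to the functions $(a \cdot \sigma)^d$, and by density to all
  functions of the direction (\<open>angular_moments_determine\<close>). Localising on thin annuli shows that $u / v$
  depends on $|x|$ only (\<open>quotient_not_less\<close>). Comparison with one explicit solution finishes the
  proof (\<open>hardy_solution_classification\<close>).
\<close>

section \<open>The equation \<open>f'' = a\<^sup>2 f\<close> on the line\<close>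

lemma exponential_solutions:
  fixes f f' f'' :: "real \<Rightarrow> real"
  assumes a: "a > 0"
    and f: "\<And>t. (f has_real_derivative f' t) (at t)"
    and f': "\<And>t. (f' has_real_derivative f'' t) (at t)"
    and eq: "\<And>t. f'' t = a\<^sup>2 * f t"
  obtains A B where "\<And>t. f t = A * exp (a * t) + B * exp (- a * t)"
proof -
  have "((\<lambda>t. (f' t + a * f t) * exp (- a * t)) has_real_derivative 0) (at t)" for t
    by (rule derivative_eq_intros f f' refl | simp add: eq algebra_simps power2_eq_square)+
  from DERIV_isconst_all[OF allI[OF this]]
  obtain C where C: "\<And>t. (f' t + a * f t) * exp (- a * t) = C" by blast
  have "((\<lambda>t. (f' t - a * f t) * exp (a * t)) has_real_derivative 0) (at t)" for t
    by (rule derivative_eq_intros f f' refl | simp add: eq algebra_simps power2_eq_square)+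
  from DERIV_isconst_all[OF allI[OF this]]
  obtain E where E: "\<And>t. (f' t - a * f t) * exp (a * t) = E" by blast
  have "f t = C / (2 * a) * exp (a * t) + - E / (2 * a) * exp (- a * t)" for t
  proof -
    have "f' t + a * f t = C * exp (a * t)" "f' t - a * f t = E * exp (- a * t)"
      using C[of t] E[of t] by (simp_all add: exp_minus field_simps)
    then have "2 * a * f t = C * exp (a * t) - E * exp (- a * t)" by algebra
    then show ?thesis using a by (simp add: field_simps)
  qed
  then show ?thesis using that by blast
qed

text \<open>
  Multiplying by \<open>exp (- a * t)\<close> and letting \<open>t\<close> tend to infinity isolates \<open>A\<close>; reflecting \<open>t\<close> isolates \<open>B\<close>.
  This removes every angular mode above the lowest one.
\<close>

lemma exponentials_eq_0_of_slower_growth: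
  fixes a b :: real
  assumes ab: "\<bar>b\<bar> < a"
    and bound: "\<And>t. \<bar>A * exp (a * t) + B * exp (- a * t)\<bar> \<le> C * exp (b * t) + E * exp (- b * t)"
  shows "A = 0" and "B = 0"
proof -
  have tend: "((\<lambda>t. c * exp (- (m * t))) \<longlongrightarrow> 0) at_top" if "m > 0" for c m :: real
  proof -
    have "filterlim (\<lambda>t. m * t) at_top at_top"
      using that by (simp add: filterlim_tendsto_pos_mult_at_top[OF tendsto_const] filterlim_ident)
    then have "((\<lambda>t. exp (- (m * t))) \<longlongrightarrow> 0) at_top"
      by (intro filterlim_compose[OF exp_at_bot] filterlim_uminus_at_bot_at_top[THEN filterlim_compose])
    from tendsto_mult[OF tendsto_const[of c] this] show ?thesis by simp
  qed
  have zero: "P = 0" if le: "\<And>t. \<bar>P * exp (a * t) + Q * exp (- a * t)\<bar> \<le> R * exp (b * t) + S * exp (- b * t)"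
    for P Q R S
  proof -
    have "\<bar>P\<bar> \<le> R * exp (- ((a - b) * t)) + S * exp (- ((a + b) * t)) + \<bar>Q\<bar> * exp (- ((2 * a) * t))" for t
    proof -
      have "\<bar>P * exp (a * t)\<bar> \<le> \<bar>P * exp (a * t) + Q * exp (- a * t)\<bar> + \<bar>Q * exp (- a * t)\<bar>" by linarith
      also have "\<dots> \<le> R * exp (b * t) + S * exp (- b * t) + \<bar>Q\<bar> * exp (- a * t)"
        using le[of t] by (simp add: abs_mult)
      finally have "\<bar>P\<bar> * exp (a * t) * exp (- a * t)
          \<le> (R * exp (b * t) + S * exp (- b * t) + \<bar>Q\<bar> * exp (- a * t)) * exp (- a * t)"
        by (intro mult_right_mono) (auto simp: abs_mult)
      then show ?thesis
        by (simp add: algebra_simps flip: exp_add)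
    qed
    moreover have "((\<lambda>t. R * exp (- ((a - b) * t)) + S * exp (- ((a + b) * t)) + \<bar>Q\<bar> * exp (- ((2 * a) * t)))
        \<longlongrightarrow> 0 + 0 + 0) at_top"
      using ab by (intro tendsto_add tend) auto
    ultimately have "\<bar>P\<bar> \<le> 0 + 0 + 0"
      by (intro tendsto_lowerbound[where F = at_top and a = "\<bar>P\<bar>"]) (auto intro!: always_eventually)
    then show "P = 0" by simp
  qed
  show "A = 0" by (rule zero[OF bound])
  show "B = 0"
    by (rule zero[of B A E C]) (use bound[of "- t" for t] in \<open>simp add: add.commute\<close>)
qed

lemma nonneg_exponentials:
  fixes a :: real
  assumes a: "a > 0" and pos: "\<And>t. A * exp (a * t) + B * exp (- a * t) \<ge> 0"
  shows "A \<ge> 0" and "B \<ge> 0"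
proof -
  have nn: "P \<ge> 0" if "\<And>t. P * exp (a * t) + Q * exp (- a * t) \<ge> 0" for P Q
  proof (rule ccontr)
    assume "\<not> P \<ge> 0"
    have "0 \<le> P + Q * exp (- (2 * a * t))" for t :: real
    proof -
      have "0 \<le> (P * exp (a * t) + Q * exp (- a * t)) * exp (- a * t)"
        using that[of t] by simp
      then show ?thesis by (simp add: distrib_right mult.assoc mult_exp_exp)
    qed
    moreover have "((\<lambda>t. P + Q * exp (- (2 * a * t))) \<longlongrightarrow> P + Q * 0) at_top"
    proof (intro tendsto_intros filterlim_compose[OF exp_at_bot] filterlim_uminus_at_bot_at_top[THEN filterlim_compose])
      show "filterlim (\<lambda>t. 2 * a * t) at_top at_top"
        using a by (simp add: filterlim_tendsto_pos_mult_at_top[OF tendsto_const] filterlim_ident)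
    qed
    ultimately have "0 \<le> P + Q * 0"
      by (intro tendsto_lowerbound[where F = at_top and a = "0"]) (auto intro!: always_eventually)
    with \<open>\<not> P \<ge> 0\<close> show False by simp
  qed
  show "A \<ge> 0" by (rule nn[OF pos])
  show "B \<ge> 0" by (rule nn[of B A]) (use pos[of "- t" for t] in \<open>simp add: add.commute\<close>)
qed

section \<open>Bump functions\<close>

text \<open>
  The square of the positive part has error \<open>h\<^sup>2\<close> at most in its first-order expansion, at the corner \<open>0\<close> included.
  Hence the cube, from which the bumps are built, is of class \<open>C\<^sup>2\<close>; this is all the smoothness that a
  test function for a second-order equation has to have.
\<close>

lemma has_real_derivative_pos_part_square:
  "((\<lambda>y. (max 0 y)\<^sup>2) has_real_derivative 2 * max 0 y) (at (y::real))"
proof -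
  have bound: "\<bar>(max 0 (y + h))\<^sup>2 - (max 0 y)\<^sup>2 - 2 * max 0 y * h\<bar> \<le> h\<^sup>2" for h
  proof -
    consider "y \<ge> 0" "y + h \<ge> 0" | "y \<ge> 0" "y + h < 0" | "y < 0" "y + h \<ge> 0" | "y < 0" "y + h < 0"
      by linarith
    then show ?thesis
    proof cases
      case 2
      then have "y * y \<le> y * - h" by (intro mult_left_mono) auto
      then have "y * y \<le> - (y * h)" by simp
      moreover have "0 \<le> (y + h) * (y + h)" "0 \<le> y * y" "0 \<le> h * h" by simp_all
      moreover have "(y + h) * (y + h) = y * y + 2 * (y * h) + h * h" by algebra
      ultimately have "\<bar>- (y * y) - 2 * (y * h)\<bar> \<le> h * h" by linarith
      then show ?thesis using 2 by (simp add: power2_eq_square)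
    next
      case 3
      then have "\<bar>y + h\<bar> \<le> \<bar>h\<bar>" by linarith
      then have "(y + h)\<^sup>2 \<le> h\<^sup>2" by (simp add: abs_le_square_iff)
      with 3 show ?thesis by simp
    qed (auto simp: power2_eq_square algebra_simps)
  qed
  have "norm (((max 0 (y + h))\<^sup>2 - (max 0 y)\<^sup>2) / h - 2 * max 0 y) \<le> \<bar>h\<bar>" if "h \<noteq> 0" for h
  proof -
    have "((max 0 (y + h))\<^sup>2 - (max 0 y)\<^sup>2) / h - 2 * max 0 y
        = ((max 0 (y + h))\<^sup>2 - (max 0 y)\<^sup>2 - 2 * max 0 y * h) / h"
      using that by (simp add: diff_divide_distrib)
    then have "norm (((max 0 (y + h))\<^sup>2 - (max 0 y)\<^sup>2) / h - 2 * max 0 y)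
        = \<bar>(max 0 (y + h))\<^sup>2 - (max 0 y)\<^sup>2 - 2 * max 0 y * h\<bar> / \<bar>h\<bar>"
      by (simp only: real_norm_def abs_divide)
    also have "\<dots> \<le> h\<^sup>2 / \<bar>h\<bar>" by (intro divide_right_mono bound) simp
    also have "\<dots> = \<bar>h\<bar>" using that by (simp add: power2_eq_square abs_if)
    finally show ?thesis .
  qed
  then have "((\<lambda>h. ((max 0 (y + h))\<^sup>2 - (max 0 y)\<^sup>2) / h - 2 * max 0 y) \<longlongrightarrow> 0) (at 0)"
    by (intro Lim_null_comparison[OF _ tendsto_rabs_zero[OF tendsto_ident_at]])
       (simp add: eventually_at_filter)
  then show ?thesis
    unfolding DERIV_def by (rule LIM_zero_cancel)
qed

lemma has_real_derivative_pos_part_cube: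
  "((\<lambda>y. (max 0 y) ^ 3) has_real_derivative 3 * (max 0 y)\<^sup>2) (at (y::real))"
proof -
  have eq: "(\<lambda>y::real. (max 0 y) ^ 3) = (\<lambda>y. y * (max 0 y)\<^sup>2)"
    by (auto simp: fun_eq_iff max_def power2_eq_square power3_eq_cube)
  show ?thesis unfolding eq
    by (rule derivative_eq_intros has_real_derivative_pos_part_square refl)+
       (auto simp: max_def power2_eq_square)
qed

definition bump :: "real \<Rightarrow> real \<Rightarrow> real" where
  "bump \<epsilon> t = (max 0 (\<epsilon>\<^sup>2 - t\<^sup>2)) ^ 3"

definition bump' :: "real \<Rightarrow> real \<Rightarrow> real" where
  "bump' \<epsilon> t = - 6 * t * (max 0 (\<epsilon>\<^sup>2 - t\<^sup>2))\<^sup>2"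

definition bump'' :: "real \<Rightarrow> real \<Rightarrow> real" where
  "bump'' \<epsilon> t = - 6 * (max 0 (\<epsilon>\<^sup>2 - t\<^sup>2))\<^sup>2 + 24 * t\<^sup>2 * max 0 (\<epsilon>\<^sup>2 - t\<^sup>2)"

lemma DERIV_bump: "(bump \<epsilon> has_real_derivative bump' \<epsilon> t) (at t)"
  unfolding bump_def[abs_def] bump'_def
  by (rule DERIV_cong, rule DERIV_chain2[OF has_real_derivative_pos_part_cube])
     (rule derivative_eq_intros refl | simp)+

lemma DERIV_bump': "(bump' \<epsilon> has_real_derivative bump'' \<epsilon> t) (at t)"
proof -
  have "((\<lambda>t. (max 0 (\<epsilon>\<^sup>2 - t\<^sup>2))\<^sup>2) has_real_derivative 2 * max 0 (\<epsilon>\<^sup>2 - t\<^sup>2) * (- (2 * t))) (at t)"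
    by (rule DERIV_chain2[OF has_real_derivative_pos_part_square])
       (rule derivative_eq_intros refl | simp)+
  from DERIV_mult[OF DERIV_cmult[OF DERIV_ident, of "- 6"] this] show ?thesis
    unfolding bump'_def[abs_def] bump''_def by (simp add: power2_eq_square algebra_simps)
qed

lemma continuous_bump:
  "continuous_on UNIV (bump \<epsilon>)" "continuous_on UNIV (bump' \<epsilon>)" "continuous_on UNIV (bump'' \<epsilon>)"
  unfolding bump_def[abs_def] bump'_def[abs_def] bump''_def[abs_def]
  by (intro continuous_intros)+

lemma bump_eq_0:
  assumes "\<epsilon> > 0" "\<bar>t\<bar> \<ge> \<epsilon>" shows "bump \<epsilon> t = 0" "bump' \<epsilon> t = 0" "bump'' \<epsilon> t = 0"
proof -
  have "\<epsilon>\<^sup>2 \<le> t\<^sup>2" using assms by (simp add: abs_le_square_iff[symmetric])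
  then show "bump \<epsilon> t = 0" "bump' \<epsilon> t = 0" "bump'' \<epsilon> t = 0"
    by (auto simp: bump_def bump'_def bump''_def)
qed

lemma bump_nonneg: "bump \<epsilon> t \<ge> 0"
  by (simp add: bump_def)

lemma bump_pos: "\<epsilon> > 0 \<Longrightarrow> \<bar>t\<bar> < \<epsilon> \<Longrightarrow> bump \<epsilon> t > 0"
  using power_strict_mono[of "\<bar>t\<bar>" \<epsilon> 2] by (simp add: bump_def less_max_iff_disj)

lemma compactly_supported_uniformly_continuous:
  fixes g :: "real \<Rightarrow> real"
  assumes cont: "continuous_on UNIV g" and supp: "\<And>t. \<bar>t\<bar> \<ge> m \<Longrightarrow> g t = 0"
  shows "uniformly_continuous_on UNIV g"
proof -
  have "uniformly_continuous_on {-\<bar>m\<bar>-1..\<bar>m\<bar>+1} g"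
    by (rule compact_uniformly_continuous) (auto intro: continuous_on_subset[OF cont])
  show ?thesis
    unfolding uniformly_continuous_on_def
  proof (intro allI impI)
    fix e :: real assume "e > 0"
    with \<open>uniformly_continuous_on _ g\<close> obtain d where d: "d > 0"
      "\<And>x y. x \<in> {-\<bar>m\<bar>-1..\<bar>m\<bar>+1} \<Longrightarrow> y \<in> {-\<bar>m\<bar>-1..\<bar>m\<bar>+1} \<Longrightarrow> dist y x < d \<Longrightarrow> dist (g y) (g x) < e"
      unfolding uniformly_continuous_on_def by metis
    have "dist (g y) (g x) < e" if "dist y x < min d 1" for x y
    proof (cases "\<bar>x\<bar> \<le> \<bar>m\<bar> + 1 \<and> \<bar>y\<bar> \<le> \<bar>m\<bar> + 1")
      case True
      then show ?thesis using d(2)[of x y] that by (auto simp: abs_le_iff)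
    next
      case False
      then have "\<bar>x\<bar> \<ge> m" "\<bar>y\<bar> \<ge> m" using that by (auto simp: dist_real_def)
      then show ?thesis using supp \<open>e > 0\<close> by simp
    qed
    then show "\<exists>d>0. \<forall>x\<in>UNIV. \<forall>x'\<in>UNIV. dist x' x < d \<longrightarrow> dist (g x') (g x) < e"
      using d(1) by (intro exI[of _ "min d 1"]) auto
  qed
qed

section \<open>Derivatives along the coordinate axes\<close>

text \<open>
  The relational form of \<open>partial_deriv\<close>. It records that the derivative exists, so the calculus rules
  for real functions of one variable transfer.
\<close>

definition has_axis_deriv :: "(real ^ 'n::finite \<Rightarrow> real) \<Rightarrow> real \<Rightarrow> 'n \<Rightarrow> real ^ 'n \<Rightarrow> bool" where
  "has_axis_deriv f D i x \<longleftrightarrow> ((\<lambda>s. f (x + s *\<^sub>R axis i 1)) has_real_derivative D) (at 0)"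

lemma partial_deriv_eq: "has_axis_deriv f D i x \<Longrightarrow> partial_deriv i f x = D"
  unfolding has_axis_deriv_def partial_deriv_def by (rule DERIV_imp_deriv)

lemma tendsto_axis_line:
  fixes x :: "real ^ 'n::finite"
  shows "((\<lambda>s. x + s *\<^sub>R axis i 1) \<longlongrightarrow> x) (at 0)"
proof -
  have "((\<lambda>s. x + s *\<^sub>R axis i (1::real)) \<longlongrightarrow> x + 0 *\<^sub>R axis i 1) (at (0::real))"
    by (intro tendsto_intros)
  then show ?thesis by simp
qed

lemma has_axis_deriv_cong_open:
  assumes "has_axis_deriv f D i x" "open S" "x \<in> S" "\<And>y. y \<in> S \<Longrightarrow> f y = g y"
  shows "has_axis_deriv g D i x"
proof -
  have "eventually (\<lambda>s. x + s *\<^sub>R axis i 1 \<in> S) (at 0)"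
    using topological_tendstoD[OF tendsto_axis_line] assms(2,3) by blast
  with assms(3) have "eventually (\<lambda>s. x + s *\<^sub>R axis i 1 \<in> S) (nhds 0)"
    by (simp add: eventually_nhds_conv_at)
  then have "eventually (\<lambda>s. f (x + s *\<^sub>R axis i 1) = g (x + s *\<^sub>R axis i 1)) (nhds 0)"
    by eventually_elim (simp add: assms(4))
  with assms(1) show ?thesis
    unfolding has_axis_deriv_def
    by (subst (asm) DERIV_cong_ev[OF refl _ refl])
qed

lemma has_axis_deriv_along_line:
  assumes "has_axis_deriv f D i (x + s *\<^sub>R axis i 1)"
  shows "((\<lambda>s. f (x + s *\<^sub>R axis i 1)) has_real_derivative D) (at s)"
proof -
  have "((\<lambda>t. f (x + (t + s) *\<^sub>R axis i 1)) has_real_derivative D) (at 0)"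
    using assms unfolding has_axis_deriv_def by (simp add: algebra_simps)
  then show ?thesis
    using DERIV_shift[of "\<lambda>s. f (x + s *\<^sub>R axis i 1)" D 0 s] by simp
qed

lemma has_axis_deriv_component: "has_axis_deriv (\<lambda>x. x $ k) (axis i 1 $ k) i x"
  unfolding has_axis_deriv_def by (auto intro!: derivative_eq_intros)

lemma has_axis_deriv_inner: "has_axis_deriv (\<lambda>x. a \<bullet> x) (a $ i) i x"
  unfolding has_axis_deriv_def
  by (auto intro!: derivative_eq_intros simp: inner_axis inner_add_right)

lemma has_axis_deriv_inner_self: "has_axis_deriv (\<lambda>x. x \<bullet> x) (2 * x $ i) i x"
  unfolding has_axis_deriv_def
  by (auto intro!: derivative_eq_intros simp: inner_axis inner_axis' inner_add_right inner_add_left inner_commute)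

lemma has_axis_deriv_ln_norm:
  assumes "x \<noteq> 0"
  shows "has_axis_deriv (\<lambda>x. ln (norm x)) (x $ i / (x \<bullet> x)) i x"
proof -
  have pos: "x \<bullet> x > 0" using assms by simp
  have "has_axis_deriv (\<lambda>x. ln (x \<bullet> x) / 2) (x $ i / (x \<bullet> x)) i x"
    using has_axis_deriv_inner_self[where i = i and x = x] pos unfolding has_axis_deriv_def
    by (auto intro!: derivative_eq_intros simp: field_simps)
  then show ?thesis
    by (rule has_axis_deriv_cong_open[of _ _ _ _ "- {0}"])
       (use assms in \<open>auto simp: norm_eq_sqrt_inner ln_sqrt\<close>)
qed

lemma has_axis_deriv_add:
  "has_axis_deriv f D i x \<Longrightarrow> has_axis_deriv g E i x \<Longrightarrow> has_axis_deriv (\<lambda>x. f x + g x) (D + E) i x"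
  unfolding has_axis_deriv_def by (rule DERIV_add)

lemma has_axis_deriv_const: "has_axis_deriv (\<lambda>x. c) 0 i x"
  unfolding has_axis_deriv_def by simp

lemma has_axis_deriv_mult:
  "has_axis_deriv f D i x \<Longrightarrow> has_axis_deriv g E i x \<Longrightarrow>
    has_axis_deriv (\<lambda>x. f x * g x) (D * g x + f x * E) i x"
  unfolding has_axis_deriv_def by (drule (1) DERIV_mult) (simp add: mult.commute)

lemma has_axis_deriv_diff:
  "has_axis_deriv f D i x \<Longrightarrow> has_axis_deriv g E i x \<Longrightarrow> has_axis_deriv (\<lambda>x. f x - g x) (D - E) i x"
  unfolding has_axis_deriv_def by (rule DERIV_diff)

lemma has_axis_deriv_compose:
  "(g has_real_derivative D) (at (f x)) \<Longrightarrow> has_axis_deriv f E i x \<Longrightarrow>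
    has_axis_deriv (\<lambda>x. g (f x)) (D * E) i x"
  unfolding has_axis_deriv_def
  using DERIV_chain2[of g D "\<lambda>s. f (x + s *\<^sub>R axis i 1)" 0 E UNIV] by simp

section \<open>Separated functions\<close>

text \<open>
  The functions \<open>x\<^sub>k (a \<bullet> x)\<^sup>d g(ln |x|)\<close> serve both as test functions and, for \<open>d = 0\<close>, as the solutions
  themselves. For \<open>a\<close> orthogonal to the \<open>k\<close>-axis, \<open>x\<^sub>k (a \<bullet> x)\<^sup>d\<close> vanishes on the boundary and its Laplacian is a multiple of
  \<open>x\<^sub>k (a \<bullet> x)\<^sup>d\<^sup>-\<^sup>2\<close>, so the family is stable under the Laplacian, and no eigenfunctions of
  the sphere are needed. Writing the radial factor in terms of \<open>ln |x|\<close> turns the dilation-invariant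
  operator into one with constant coefficients.
\<close>

definition sepfun :: "'n::finite \<Rightarrow> real ^ 'n \<Rightarrow> nat \<Rightarrow> (real \<Rightarrow> real) \<Rightarrow> real ^ 'n \<Rightarrow> real" where
  "sepfun k a d g x = x $ k * (a \<bullet> x) ^ d * g (ln (norm x))"

text \<open>
  The first and second partial derivatives of \<open>sepfun\<close> along the axis \<open>i\<close>, where \<open>g'\<close> and \<open>g''\<close> stand for the derivatives of
  \<open>g\<close>.
\<close>

definition sepfun1 where
  "sepfun1 k a d g g' i x = axis i 1 $ k * (a \<bullet> x) ^ d * g (ln (norm x))
     + x $ k * (real d * (a \<bullet> x) ^ (d - 1) * a $ i) * g (ln (norm x))
     + x $ k * (a \<bullet> x) ^ d * (g' (ln (norm x)) * (x $ i / (x \<bullet> x)))"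

definition sepfun2 where
  "sepfun2 k a d g g' g'' i x =
     2 * axis i 1 $ k * (real d * (a \<bullet> x) ^ (d - 1) * a $ i) * g (ln (norm x))
     + 2 * axis i 1 $ k * (a \<bullet> x) ^ d * (g' (ln (norm x)) * (x $ i / (x \<bullet> x)))
     + x $ k * (real d * (real (d - 1) * (a \<bullet> x) ^ (d - 2) * a $ i) * a $ i) * g (ln (norm x))
     + 2 * x $ k * (real d * (a \<bullet> x) ^ (d - 1) * a $ i) * (g' (ln (norm x)) * (x $ i / (x \<bullet> x)))
     + x $ k * (a \<bullet> x) ^ d * (g'' (ln (norm x)) * (x $ i / (x \<bullet> x))\<^sup>2
         + g' (ln (norm x)) * (1 / (x \<bullet> x) - 2 * (x $ i)\<^sup>2 / (x \<bullet> x)\<^sup>2))"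

lemma has_axis_deriv_inner_power:
  "has_axis_deriv (\<lambda>x. (a \<bullet> x) ^ d) (real d * (a \<bullet> x) ^ (d - 1) * a $ i) i x"
  using DERIV_power[OF has_axis_deriv_inner[of a i x, unfolded has_axis_deriv_def], of d]
  unfolding has_axis_deriv_def by (simp add: mult_ac)

lemma has_axis_deriv_sepfun:
  assumes "x \<noteq> 0" and g: "(g has_real_derivative g' (ln (norm x))) (at (ln (norm x)))"
  shows "has_axis_deriv (sepfun k a d g) (sepfun1 k a d g g' i x) i x"
  using has_axis_deriv_mult[OF has_axis_deriv_mult[OF has_axis_deriv_component has_axis_deriv_inner_power]
      has_axis_deriv_compose[OF g has_axis_deriv_ln_norm[OF assms(1)]], of k a d i]
  by (simp add: sepfun_def[abs_def] sepfun1_def distrib_right)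

lemma has_axis_deriv_sepfun1:
  assumes x: "x \<noteq> 0" and g: "(g has_real_derivative g' (ln (norm x))) (at (ln (norm x)))"
    and g': "(g' has_real_derivative g'' (ln (norm x))) (at (ln (norm x)))"
  shows "has_axis_deriv (sepfun1 k a d g g' i) (sepfun2 k a d g g' g'' i x) i x"
proof -
  note G = has_axis_deriv_compose[OF g has_axis_deriv_ln_norm[OF x]]
    has_axis_deriv_compose[OF g' has_axis_deriv_ln_norm[OF x]]
  have inv: "has_axis_deriv (\<lambda>x. x $ i / (x \<bullet> x)) (1 / (x \<bullet> x) - 2 * (x $ i)\<^sup>2 / (x \<bullet> x)\<^sup>2) i x"
  proof -
    have nz: "x \<bullet> x \<noteq> 0" using x by simp
    have "has_axis_deriv (\<lambda>x. x $ i / (x \<bullet> x))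
        ((axis i 1 $ i * (x \<bullet> x) - x $ i * (2 * x $ i)) / ((x \<bullet> x) * (x \<bullet> x))) i x"
      using DERIV_divide[OF has_axis_deriv_component[of i i x, unfolded has_axis_deriv_def]
          has_axis_deriv_inner_self[of x i, unfolded has_axis_deriv_def]] nz
      unfolding has_axis_deriv_def by simp
    moreover have "(axis i 1 $ i * (x \<bullet> x) - x $ i * (2 * x $ i)) / ((x \<bullet> x) * (x \<bullet> x))
        = 1 / (x \<bullet> x) - 2 * (x $ i)\<^sup>2 / (x \<bullet> x)\<^sup>2"
      using nz by (simp add: diff_divide_distrib power2_eq_square)
    ultimately show ?thesis by simp
  qed
  have P: "has_axis_deriv (\<lambda>x. (a \<bullet> x) ^ (d - 1)) (real (d - 1) * (a \<bullet> x) ^ (d - 2) * a $ i) i x"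
    using has_axis_deriv_inner_power[where d = "d - 1"] by (simp add: numeral_2_eq_2)
  have unique_eq: "D = E \<Longrightarrow> has_axis_deriv f D i x \<Longrightarrow> has_axis_deriv f E i x" for f D E by simp
  show ?thesis
    unfolding sepfun1_def[abs_def]
    apply (rule unique_eq)
     prefer 2
     apply (rule has_axis_deriv_add has_axis_deriv_mult has_axis_deriv_const has_axis_deriv_component
       P has_axis_deriv_inner_power G inv)+
    apply (simp only: sepfun2_def ring_distribs mult_1_left mult_zero_left mult_zero_right add_0_left add_0_right)
    apply (simp add: mult_ac add_ac power2_eq_square axis_def)
    done
qed

lemma sum_axis_component: "(\<Sum>i\<in>UNIV. axis i (1::real) $ k * f i) = f k"
  by (simp add: axis_def if_distrib[of "\<lambda>c. c * _"] cong: if_cong)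

lemma inner_self_vec: "(x::real^'n::finite) \<bullet> x = (\<Sum>i\<in>UNIV. (x $ i)\<^sup>2)"
  by (simp add: inner_vec_def power2_eq_square)

text \<open>
  The Laplacian of \<open>sepfun\<close>. The cross term of \<open>x\<^sub>k\<close> with \<open>(a \<bullet> x)\<^sup>d\<close> drops out because \<open>a\<close> is orthogonal to the
  \<open>k\<close>-axis, and Euler's identity for the homogeneous factor of degree \<open>d + 1\<close> gives the coefficient
  of \<open>g'\<close>.
\<close>

lemma sum_sepfun2:
  fixes a x :: "real ^ 'n::finite"
  assumes "x \<noteq> 0" "a $ k = 0"
  shows "(\<Sum>i\<in>UNIV. sepfun2 k a d g g' g'' i x)
    = x $ k * (a \<bullet> x) ^ d / (x \<bullet> x) * (g'' (ln (norm x)) + (real CARD('n) + 2 * real d) * g' (ln (norm x)))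
      + real (d * (d - 1)) * (a \<bullet> a) * (x $ k * (a \<bullet> x) ^ (d - 2) * g (ln (norm x)))"
proof -
  define A \<rho> G G' G'' where A: "A = a \<bullet> x" "\<rho> = x \<bullet> x" "G = g (ln (norm x))" "G' = g' (ln (norm x))" "G'' = g'' (ln (norm x))"
  have "\<rho> \<noteq> 0" using assms A by simp
  have inner_axa: "(\<Sum>i\<in>UNIV. a $ i * x $ i) = A" by (simp add: A inner_vec_def)
  have "(\<Sum>i\<in>UNIV. sepfun2 k a d g g' g'' i x) = 
     (\<Sum>i\<in>UNIV. axis i 1 $ k * (2 * real d * A ^ (d - 1) * G * a $ i))
     + (\<Sum>i\<in>UNIV. axis i 1 $ k * (2 * A ^ d * G' / \<rho> * x $ i))
     + (\<Sum>i\<in>UNIV. (x $ k * real d * real (d - 1) * A ^ (d - 2) * G) * (a $ i)\<^sup>2)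
     + (\<Sum>i\<in>UNIV. (2 * x $ k * real d * A ^ (d - 1) * G' / \<rho>) * (a $ i * x $ i))
     + ((\<Sum>i\<in>UNIV. (x $ k * A ^ d * (G'' / \<rho>\<^sup>2 - 2 * G' / \<rho>\<^sup>2)) * (x $ i)\<^sup>2)
     + (\<Sum>i\<in>(UNIV::'n set). x $ k * A ^ d * G' / \<rho>))"
    unfolding sum.distrib[symmetric] 
    by (rule sum.cong[OF refl]) (simp add: sepfun2_def A[symmetric] divide_inverse power_mult_distrib power_inverse
          algebra_simps power2_eq_square)
  also have "\<dots> = 2 * x $ k * A ^ d * G' / \<rho> + x $ k * real d * real (d - 1) * A ^ (d - 2) * G * (a \<bullet> a)
     + 2 * x $ k * real d * (A ^ (d - 1) * A) * G' / \<rho>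
     + (x $ k * A ^ d * (G'' / \<rho>\<^sup>2 - 2 * G' / \<rho>\<^sup>2) * \<rho> + real CARD('n) * x $ k * A ^ d * G' / \<rho>)"
    unfolding sum_axis_component sum_distrib_left[symmetric]
    by (simp add: assms(2) inner_self_vec[symmetric] A(2)[symmetric] inner_axa mult_ac)
  also have "2 * x $ k * real d * (A ^ (d - 1) * A) * G' / \<rho> = 2 * x $ k * real d * A ^ d * G' / \<rho>"
    by (cases d) (simp_all add: mult.commute)
  also have "x $ k * A ^ d * (G'' / \<rho>\<^sup>2 - 2 * G' / \<rho>\<^sup>2) * \<rho> = x $ k * A ^ d / \<rho> * (G'' - 2 * G')"
    using \<open>\<rho> \<noteq> 0\<close> by (simp add: power2_eq_square diff_divide_distrib[symmetric])
  finally show ?thesis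
    unfolding A[symmetric] of_nat_mult
    by (simp only: divide_inverse ring_distribs) (simp add: mult_ac)
qed

section \<open>Integration over the half-space\<close>

text \<open>
  The closed half-space without the origin, the domain on which the solutions are continuous.
\<close>

definition punctured :: "'n::finite \<Rightarrow> (real ^ 'n) set" where
  "punctured k = {x. 0 \<le> x $ k} - {0}"

lemma half_space_iff [simp]: "x \<in> half_space k \<longleftrightarrow> 0 < x $ k"
  by (simp add: half_space_def)

lemma punctured_iff [simp]: "x \<in> punctured k \<longleftrightarrow> 0 \<le> x $ k \<and> x \<noteq> 0"
  by (simp add: punctured_def)

lemma half_space_imp_nonzero: "0 < x $ k \<Longrightarrow> (x :: real ^ 'n::finite) \<noteq> 0"
  by auto

lemma open_half_space: "open (half_space k)"
  unfolding half_space_def by (rule open_halfspace_component_gt_cart)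

lemma half_space_borel [measurable]: "half_space k \<in> sets borel"
  by (intro borel_open open_half_space)

lemma closure_half_space_minus_origin: "closure (half_space k) - {0} = punctured k"
  unfolding half_space_def punctured_def by (simp add: closure_halfspace_component_gt)

lemma compact_half_annulus: "compact {x :: real ^ 'n::finite. 0 \<le> x $ k \<and> r \<le> norm x \<and> norm x \<le> R}"
proof -
  have "{x :: real ^ 'n. 0 \<le> x $ k \<and> r \<le> norm x \<and> norm x \<le> R} = {x. x $ k \<ge> 0} \<inter> (- ball 0 r) \<inter> cball 0 R"
    by auto
  moreover have "compact (\<dots>)"
    by (intro closed_Int_compact closed_Int closed_halfspace_component_ge_cart compact_cball) auto
  ultimately show ?thesis by simp
qed

lemma set_integrable_half_space:
  fixes f :: "real ^ 'n::finite \<Rightarrow> real"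
  assumes "0 < r" and cont: "continuous_on (punctured k) f"
    and supp: "\<And>x. 0 < x $ k \<Longrightarrow> \<not> (r \<le> norm x \<and> norm x \<le> R) \<Longrightarrow> f x = 0"
  shows "set_integrable lborel (half_space k) f"
proof -
  let ?S = "{x :: real ^ 'n. 0 \<le> x $ k \<and> r \<le> norm x \<and> norm x \<le> R}"
  have "set_integrable lborel ?S f"
    unfolding set_integrable_def using \<open>0 < r\<close>
    by (intro borel_integrable_compact compact_half_annulus continuous_on_subset[OF cont]) auto
  then have "set_integrable lborel (half_space k \<inter> ?S) f"
    by (rule set_integrable_subset) (auto simp: compact_half_annulus[THEN compact_imp_closed])
  then show ?thesis
    unfolding set_integrable_def
    by (rule back_subst[where P = "integrable lborel"])
       (use supp in \<open>auto simp: fun_eq_iff indicator_def\<close>)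
qed

lemma set_integral_abs_bound:
  fixes f :: "'a \<Rightarrow> real"
  shows "\<bar>LINT x:A|M. f x\<bar> \<le> (LINT x:A|M. \<bar>f x\<bar>)"
  using integral_abs_bound[of M "\<lambda>x. indicator A x *\<^sub>R f x"]
  by (simp add: set_lebesgue_integral_def abs_mult)

lemma AE_off_hyperplane: "AE x :: real ^ 'n::finite in lborel. x $ k \<noteq> 0"
proof -
  have "negligible {x :: real ^ 'n. x $ k = 0}"
    by (rule negligible_standard_hyperplane_cart)
  then have "AE x :: real ^ 'n in lebesgue. x $ k \<noteq> 0"
    by (intro AE_I'[of "{x :: real ^ 'n. x $ k = 0}"]) (auto simp: negligible_iff_null_sets)
  then show ?thesis by (simp add: AE_completion_iff)
qed

lemma lborel_integral_translate:
  fixes f :: "'a::euclidean_space \<Rightarrow> real"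
  assumes "integrable lborel f"
  shows "integrable lborel (\<lambda>x. f (x + c))" and "(LINT x|lborel. f (x + c)) = (LINT x|lborel. f x)"
proof -
  have m: "(+) c \<in> lborel \<rightarrow>\<^sub>M borel" "f \<in> borel_measurable borel"
    using assms by auto
  have "integrable (distr lborel borel ((+) c)) f"
    using assms by (simp add: lborel_distr_plus)
  then show "integrable lborel (\<lambda>x. f (x + c))"
    by (subst (asm) integrable_distr_eq) (use m in \<open>auto simp: add.commute\<close>)
  have "(LINT x|distr lborel borel ((+) c). f x) = (LINT x|lborel. f (c + x))"
    by (rule integral_distr) (use m in auto)
  then show "(LINT x|lborel. f (x + c)) = (LINT x|lborel. f x)"
    by (simp add: lborel_distr_plus add.commute)
qed

text \<open>
  The divergence theorem for one partial derivative. The extension of \<open>F\<close> by zero is Lipschitz along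
  the axis, since \<open>F\<close> vanishes on the boundary hyperplane. Its difference quotients have integral zero by
  translation invariance of Lebesgue measure, and they converge boundedly to the derivative off the
  hyperplane, which is a null set.
\<close>

lemma integral_axis_deriv_eq_0:
  fixes F F' :: "real ^ 'n::finite \<Rightarrow> real"
  assumes "0 < r"
    and F: "continuous_on (punctured k) F" and F': "continuous_on (punctured k) F'"
    and supp: "\<And>x. x \<in> punctured k \<Longrightarrow> \<not> (r \<le> norm x \<and> norm x \<le> R) \<Longrightarrow> F x = 0 \<and> F' x = 0"
    and bdry: "\<And>x. x $ k = 0 \<Longrightarrow> x \<noteq> 0 \<Longrightarrow> F x = 0"
    and deriv: "\<And>x. 0 < x $ k \<Longrightarrow> has_axis_deriv F (F' x) i x"
  shows "(LINT x:half_space k|lborel. F' x) = 0"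
proof -
  define E where "E x = (if 0 < x $ k then F x else 0)" for x
  define E' where "E' x = (if 0 < x $ k then F' x else 0)" for x
  let ?e = "axis i 1 :: real ^ 'n"
  have E_ind: "E = (\<lambda>x. indicator (half_space k) x *\<^sub>R F x)" "E' = (\<lambda>x. indicator (half_space k) x *\<^sub>R F' x)"
    by (auto simp: E_def E'_def fun_eq_iff)
  have int: "integrable lborel E" "integrable lborel E'"
    unfolding E_ind set_integrable_def[symmetric]
    by (rule set_integrable_half_space[OF \<open>0 < r\<close> F, of R] set_integrable_half_space[OF \<open>0 < r\<close> F', of R];
        use supp half_space_imp_nonzero in \<open>force\<close>)+
  have supp_E: "E x = 0" if "\<not> (r \<le> norm x \<and> norm x \<le> R)" for x
    using supp[of x] half_space_imp_nonzero[of x k] that by (auto simp: E_def)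
  obtain M where M: "M \<ge> 0" "\<And>x. \<bar>E' x\<bar> \<le> M"
  proof -
    have "compact (F' ` {x :: real ^ 'n. 0 \<le> x $ k \<and> r \<le> norm x \<and> norm x \<le> R})"
      using \<open>0 < r\<close> by (intro compact_continuous_image compact_half_annulus continuous_on_subset[OF F']) auto
    from compact_imp_bounded[OF this]
    obtain M where "\<And>x. 0 \<le> x $ k \<Longrightarrow> r \<le> norm x \<Longrightarrow> norm x \<le> R \<Longrightarrow> \<bar>F' x\<bar> \<le> M"
      unfolding bounded_iff by auto
    note M = this
    have "\<bar>E' x\<bar> \<le> max M 0" for x
      using M[of x] supp[of x] half_space_imp_nonzero[of x k] by (cases "r \<le> norm x \<and> norm x \<le> R") (auto simp: E'_def le_max_iff_disj)
    then show ?thesis using that[of "max M 0"] by auto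
  qed
  have cont_E: "continuous_on UNIV E"
  proof -
    have "continuous_on ({x. 0 \<le> x $ k} - {0} \<union> ({x. x $ k \<le> 0} - {0})) (\<lambda>x. if 0 < x $ k then F x else 0)"
    proof (rule continuous_on_cases_local)
      let ?U = "{x :: real ^ 'n. 0 \<le> x $ k} - {0} \<union> ({x. x $ k \<le> 0} - {0})"
      have eq: "{x :: real ^ 'n. 0 \<le> x $ k} - {0} = ?U \<inter> {x. x $ k \<ge> 0}" "{x :: real ^ 'n. x $ k \<le> 0} - {0} = ?U \<inter> {x. x $ k \<le> 0}"
        by auto
      show "closedin (top_of_set ?U) ({x. 0 \<le> x $ k} - {0})"
        by (rule back_subst[of "closedin (top_of_set ?U)", OF closedin_closed_Int eq(1)[symmetric]])
           (rule closed_halfspace_component_ge_cart)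
      show "closedin (top_of_set ?U) ({x. x $ k \<le> 0} - {0})"
        by (rule back_subst[of "closedin (top_of_set ?U)", OF closedin_closed_Int eq(2)[symmetric]])
           (rule closed_halfspace_component_le_cart)
    qed (use F bdry in \<open>auto simp: punctured_def not_less intro: antisym\<close>)
    also have "{x :: real ^ 'n. 0 \<le> x $ k} - {0} \<union> ({x. x $ k \<le> 0} - {0}) = - {0}" by auto
    finally have "continuous_on (- {0}) E" unfolding E_def[abs_def] .
    moreover have "continuous_on (ball 0 r) E"
      by (rule continuous_on_eq[OF continuous_on_const[of _ 0]]) (simp add: supp_E)
    ultimately have "continuous_on (- {0} \<union> ball 0 r) E"
      by (intro continuous_on_open_Un) auto
    also have "- {0} \<union> ball 0 r = (UNIV :: (real ^ 'n) set)" using \<open>0 < r\<close> by auto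
    finally show ?thesis .
  qed
  have deriv_E: "has_axis_deriv E (E' x) i x" if "x $ k \<noteq> 0" for x
  proof (cases "0 < x $ k")
    case True
    show ?thesis
      using has_axis_deriv_cong_open[OF deriv[OF True] open_half_space, of k E] True
      by (simp add: E_def E'_def)
  next
    case False
    show ?thesis
      using has_axis_deriv_cong_open[OF has_axis_deriv_const[of 0] open_halfspace_component_lt_cart[of k 0], of x E i]
        False that by (simp add: E_def E'_def)
  qed
  have lip: "\<bar>E (x + h *\<^sub>R ?e) - E x\<bar> \<le> M * h" if "x $ k \<noteq> 0" "h > 0" for x h
  proof -
    let ?f = "\<lambda>s. E (x + s *\<^sub>R ?e)"
    have "((\<lambda>s. E' (x + s *\<^sub>R ?e)) has_integral (?f h - ?f 0)) {0..h}"
    proof (rule fundamental_theorem_of_calculus_strong)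
      show "finite {s. (x + s *\<^sub>R ?e) $ k = 0}"
        by (rule finite_subset[of _ "{- x $ k}"]) (use that in \<open>auto simp: axis_def split: if_splits\<close>)
      show "continuous_on {0..h} ?f"
        by (rule continuous_on_compose2[OF cont_E]) (auto intro!: continuous_intros)
      show "(?f has_vector_derivative E' (x + s *\<^sub>R ?e)) (at s)"
        if "s \<in> {0..h} - {s. (x + s *\<^sub>R ?e) $ k = 0}" for s
        using has_axis_deriv_along_line[OF deriv_E] that
        by (simp add: has_real_derivative_iff_has_vector_derivative)
    qed (use that in auto)
    from has_integral_bound[of M, OF _ this[folded cbox_interval]] M that show ?thesis
      by simp
  qed
  define h :: "nat \<Rightarrow> real" where "h m = inverse (real (Suc m))" for m
  have h: "h m > 0" "h m \<le> 1" for m by (auto simp: h_def inverse_le_1_iff)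
  define q where "q m x = (E (x + h m *\<^sub>R ?e) - E x) / h m" for m x
  have "(\<lambda>m. integral\<^sup>L lborel (q m)) \<longlonglongrightarrow> integral\<^sup>L lborel E'"
  proof (rule integral_dominated_convergence)
    show "E' \<in> borel_measurable lborel" using int by auto
    show "q m \<in> borel_measurable lborel" for m
      unfolding q_def[abs_def] using lborel_integral_translate(1)[OF int(1), of "h m *\<^sub>R ?e"] int(1) by auto
    show "integrable lborel (\<lambda>x :: real ^ 'n. indicator (cball 0 (R + 1)) x *\<^sub>R M)"
      by (rule borel_integrable_compact) auto
    show "AE x in lborel. (\<lambda>m. q m x) \<longlonglongrightarrow> E' x"
      using AE_off_hyperplane[of k]
    proof eventually_elim
      case (elim x)
      have "filterlim h (at 0) sequentially"
        unfolding filterlim_at h_def[abs_def] using LIMSEQ_inverse_real_of_nat by (auto simp: o_def)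
      from filterlim_compose[OF deriv_E[OF elim, unfolded has_axis_deriv_def DERIV_def] this]
      show ?case by (simp add: q_def)
    qed
    show "AE x in lborel. norm (q m x) \<le> indicator (cball 0 (R + 1)) x *\<^sub>R M" for m
      using AE_off_hyperplane[of k]
    proof eventually_elim
      case (elim x)
      show ?case
      proof (cases "norm x \<le> R + 1")
        case True
        have "\<bar>q m x\<bar> = \<bar>E (x + h m *\<^sub>R ?e) - E x\<bar> / h m"
          unfolding q_def using h[of m] by (simp add: abs_divide)
        also have "\<dots> \<le> M" using lip[OF elim h(1)[of m]] h(1)[of m] by (simp add: divide_le_eq)
        finally show ?thesis using True by simp
      next
        case False
        have "norm x \<le> norm (x + h m *\<^sub>R ?e) + norm (h m *\<^sub>R ?e)"
          using norm_triangle_sub[of x "- (h m *\<^sub>R ?e)"] by simp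
        then have "norm (x + h m *\<^sub>R ?e) > R" using False h[of m] by simp
        then have "E (x + h m *\<^sub>R ?e) = 0" "E x = 0" using False by (auto intro: supp_E)
        then show ?thesis using False by (simp add: q_def)
      qed
    qed
  qed
  moreover have "integral\<^sup>L lborel (q m) = 0" for m
    unfolding q_def[abs_def] using lborel_integral_translate[OF int(1), of "h m *\<^sub>R ?e"] int(1) by simp
  ultimately have "(\<lambda>m :: nat. 0) \<longlonglongrightarrow> integral\<^sup>L lborel E'" by simp
  then have "integral\<^sup>L lborel E' = 0"
    using LIMSEQ_unique tendsto_const by blast
  then show ?thesis
    unfolding set_lebesgue_integral_def E_ind .
qed

section \<open>Positive solutions and their weak formulation\<close>

text \<open>
  Positive solutions of \<open>- \<Delta>u = \<gamma> u / |x|\<^sup>2\<close> with zero boundary values. The witnesses \<open>u1\<close> and \<open>u2\<close> are the first and the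
  pure second partial derivatives of \<open>u\<close>, continued up to the punctured boundary.
\<close>

definition hardy_solution :: "'n::finite \<Rightarrow> real \<Rightarrow> (real ^ 'n \<Rightarrow> real) \<Rightarrow> bool" where
  "hardy_solution k \<gamma> u \<longleftrightarrow>
     continuous_on (punctured k) u \<and>
     (\<forall>x. 0 < x $ k \<longrightarrow> 0 < u x) \<and>
     (\<forall>x. x $ k = 0 \<longrightarrow> x \<noteq> 0 \<longrightarrow> u x = 0) \<and>
     (\<exists>u1 u2. (\<forall>i. continuous_on (punctured k) (u1 i) \<and> continuous_on (punctured k) (u2 i)) \<and>
        (\<forall>i x. 0 < x $ k \<longrightarrow> has_axis_deriv u (u1 i x) i x \<and> has_axis_deriv (u1 i) (u2 i x) i x) \<and>
        (\<forall>x. 0 < x $ k \<longrightarrow> (\<Sum>i\<in>UNIV. u2 i x) = - (\<gamma> / (x \<bullet> x) * u x)))"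

lemma hardy_solutionD:
  assumes "hardy_solution k \<gamma> u"
  shows "continuous_on (punctured k) u" "\<And>x. 0 < x $ k \<Longrightarrow> 0 < u x"
    "\<And>x. x $ k = 0 \<Longrightarrow> x \<noteq> 0 \<Longrightarrow> u x = 0"
  using assms unfolding hardy_solution_def by auto

lemma hardy_solutionI:
  assumes "continuous_on (punctured k) u" "\<And>x. 0 < x $ k \<Longrightarrow> 0 < u x" "\<And>x. x $ k = 0 \<Longrightarrow> x \<noteq> 0 \<Longrightarrow> u x = 0"
    and "\<And>i. continuous_on (punctured k) (u1 i)" "\<And>i. continuous_on (punctured k) (u2 i)"
    and "\<And>i x. 0 < x $ k \<Longrightarrow> has_axis_deriv u (u1 i x) i x"
    and "\<And>i x. 0 < x $ k \<Longrightarrow> has_axis_deriv (u1 i) (u2 i x) i x"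
    and "\<And>x. 0 < x $ k \<Longrightarrow> (\<Sum>i\<in>UNIV. u2 i x) = - (\<gamma> / (x \<bullet> x) * u x)"
  shows "hardy_solution k \<gamma> u"
proof -
  have "\<exists>u1 u2. (\<forall>i. continuous_on (punctured k) (u1 i) \<and> continuous_on (punctured k) (u2 i)) \<and>
      (\<forall>i x. 0 < x $ k \<longrightarrow> has_axis_deriv u (u1 i x) i x \<and> has_axis_deriv (u1 i) (u2 i x) i x) \<and>
      (\<forall>x. 0 < x $ k \<longrightarrow> (\<Sum>i\<in>UNIV. u2 i x) = - (\<gamma> / (x \<bullet> x) * u x))"
    by (rule exI[of _ u1], rule exI[of _ u2]) (use assms(4-8) in auto)
  with assms(1-3) show ?thesis unfolding hardy_solution_def by blast
qed

text \<open>
  Green's identity: \<open>u2 i * \<phi> - u * \<phi>2 i\<close> is the derivative along the axis \<open>i\<close> of \<open>u1 i * \<phi> - u * \<phi>1 i\<close>, which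
  vanishes on the boundary together with \<open>u\<close> and \<open>\<phi>\<close>.
\<close>

lemma weak_formulation:
  fixes u \<phi> :: "real ^ 'n::finite \<Rightarrow> real"
  assumes sol: "hardy_solution k \<gamma> u" and "0 < r"
    and cont: "continuous_on (punctured k) \<phi>" "\<And>i. continuous_on (punctured k) (\<phi>1 i)"
      "\<And>i. continuous_on (punctured k) (\<phi>2 i)"
    and deriv: "\<And>i x. 0 < x $ k \<Longrightarrow> has_axis_deriv \<phi> (\<phi>1 i x) i x"
      "\<And>i x. 0 < x $ k \<Longrightarrow> has_axis_deriv (\<phi>1 i) (\<phi>2 i x) i x"
    and supp: "\<And>x i. x \<in> punctured k \<Longrightarrow> \<not> (r \<le> norm x \<and> norm x \<le> R) \<Longrightarrow> \<phi> x = 0 \<and> \<phi>1 i x = 0 \<and> \<phi>2 i x = 0"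
    and bdry: "\<And>x. x $ k = 0 \<Longrightarrow> x \<noteq> 0 \<Longrightarrow> \<phi> x = 0"
  shows "(LINT x:half_space k|lborel. u x * ((\<Sum>i\<in>UNIV. \<phi>2 i x) + \<gamma> / (x \<bullet> x) * \<phi> x)) = 0"
proof -
  from sol obtain u1 u2 where u12:
      "\<forall>i. continuous_on (punctured k) (u1 i) \<and> continuous_on (punctured k) (u2 i)"
      "\<forall>i x. 0 < x $ k \<longrightarrow> has_axis_deriv u (u1 i x) i x \<and> has_axis_deriv (u1 i) (u2 i x) i x"
      "\<forall>x. 0 < x $ k \<longrightarrow> (\<Sum>i\<in>UNIV. u2 i x) = - (\<gamma> / (x \<bullet> x) * u x)"
    unfolding hardy_solution_def by (elim conjE exE) (rule that)
  have u12_cont: "continuous_on (punctured k) (u1 i)" "continuous_on (punctured k) (u2 i)" for i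
    using u12(1) by auto
  have u12_deriv: "has_axis_deriv u (u1 i x) i x" "has_axis_deriv (u1 i) (u2 i x) i x" if "0 < x $ k" for i x
    using u12(2) that by auto
  note u = hardy_solutionD[OF sol]
  define F' where "F' i x = u2 i x * \<phi> x - u x * \<phi>2 i x" for i x
  have F'_cont: "continuous_on (punctured k) (F' i)" for i
    unfolding F'_def[abs_def] by (intro continuous_intros u12_cont u cont)
  have F'_supp: "F' i x = 0" if "x \<in> punctured k" "\<not> (r \<le> norm x \<and> norm x \<le> R)" for i x
    using supp[OF that, of i] by (simp add: F'_def)
  have "(LINT x:half_space k|lborel. F' i x) = 0" for i
  proof (rule integral_axis_deriv_eq_0[OF \<open>0 < r\<close>])
    show "continuous_on (punctured k) (\<lambda>x. u1 i x * \<phi> x - u x * \<phi>1 i x)"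
      by (intro continuous_intros u12_cont u cont)
    show "u1 i x * \<phi> x - u x * \<phi>1 i x = 0 \<and> F' i x = 0"
      if "x \<in> punctured k" "\<not> (r \<le> norm x \<and> norm x \<le> R)" for x
      using supp[OF that, of i] F'_supp[OF that, of i] by simp
    show "u1 i x * \<phi> x - u x * \<phi>1 i x = 0" if "x $ k = 0" "x \<noteq> 0" for x
      using bdry[OF that] u(3)[OF that] by simp
    show "has_axis_deriv (\<lambda>x. u1 i x * \<phi> x - u x * \<phi>1 i x) (F' i x) i x" if "0 < x $ k" for x
    proof -
      have "has_axis_deriv (\<lambda>x. u1 i x * \<phi> x - u x * \<phi>1 i x)
        (u2 i x * \<phi> x + u1 i x * \<phi>1 i x - (u1 i x * \<phi>1 i x + u x * \<phi>2 i x)) i x"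
        by (intro has_axis_deriv_diff has_axis_deriv_mult u12_deriv deriv that)
      then show ?thesis by (simp add: F'_def)
    qed
  qed (rule F'_cont)
  moreover have "set_integrable lborel (half_space k) (F' i)" for i
    by (rule set_integrable_half_space[OF \<open>0 < r\<close> F'_cont, of R])
       (use F'_supp half_space_imp_nonzero in force)
  ultimately have "(LINT x|lborel. (\<Sum>i\<in>UNIV. indicator (half_space k) x *\<^sub>R F' i x)) = 0"
    unfolding set_lebesgue_integral_def set_integrable_def by (subst Bochner_Integration.integral_sum) auto
  then have "(LINT x:half_space k|lborel. (\<Sum>i\<in>UNIV. F' i x)) = 0"
    unfolding set_lebesgue_integral_def by (simp only: scaleR_sum_right)
  moreover have "(LINT x:half_space k|lborel. (\<Sum>i\<in>UNIV. F' i x))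
      = (LINT x:half_space k|lborel. - (u x * ((\<Sum>i\<in>UNIV. \<phi>2 i x) + \<gamma> / (x \<bullet> x) * \<phi> x)))"
  proof (rule set_lebesgue_integral_cong)
    have F'_sum: "(\<Sum>i\<in>UNIV. F' i x) = (\<Sum>i\<in>UNIV. u2 i x) * \<phi> x - u x * (\<Sum>i\<in>UNIV. \<phi>2 i x)" for x
      by (simp add: F'_def sum_subtractf sum_distrib_left sum_distrib_right)
    show "\<forall>x. x \<in> half_space k \<longrightarrow> (\<Sum>i\<in>UNIV. F' i x)
        = - (u x * ((\<Sum>i\<in>UNIV. \<phi>2 i x) + \<gamma> / (x \<bullet> x) * \<phi> x))"
    proof (intro allI impI)
      fix x assume "x \<in> half_space k"
      then show "(\<Sum>i\<in>UNIV. F' i x) = - (u x * ((\<Sum>i\<in>UNIV. \<phi>2 i x) + \<gamma> / (x \<bullet> x) * \<phi> x))"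
        unfolding F'_sum using u12(3)[rule_format, of x] by (simp add: algebra_simps)
    qed
  qed simp
  ultimately show ?thesis
    by (simp add: set_lebesgue_integral_def)
qed

section \<open>Averages over moving annuli\<close>

lemma annulus_of_ln_norm:
  fixes x :: "'a::real_normed_vector"
  assumes "x \<noteq> 0" "\<not> (exp (\<tau> - \<epsilon>) \<le> norm x \<and> norm x \<le> exp (\<tau> + \<epsilon>))"
  shows "\<bar>ln (norm x) - \<tau>\<bar> \<ge> \<epsilon>"
proof (rule ccontr)
  assume "\<not> \<bar>ln (norm x) - \<tau>\<bar> \<ge> \<epsilon>"
  then have "exp (\<tau> - \<epsilon>) \<le> exp (ln (norm x))" "exp (ln (norm x)) \<le> exp (\<tau> + \<epsilon>)"
    unfolding exp_le_cancel_iff by linarith+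
  then show False using assms by simp
qed

lemma continuous_on_ln_norm: "continuous_on (punctured k) (\<lambda>x. ln (norm x))"
  by (intro continuous_intros) auto

lemma set_integrable_annular:
  fixes K :: "real ^ 'n::finite \<Rightarrow> real"
  assumes "continuous_on (punctured k) K" and g: "continuous_on UNIV g" "\<And>t. \<bar>t\<bar> \<ge> \<epsilon> \<Longrightarrow> g t = 0"
  shows "set_integrable lborel (half_space k) (\<lambda>x. K x * g (ln (norm x) - \<tau>))"
proof (rule set_integrable_half_space[of "exp (\<tau> - \<epsilon>)" _ _ "exp (\<tau> + \<epsilon>)"])
  show "continuous_on (punctured k) (\<lambda>x. K x * g (ln (norm x) - \<tau>))"
    by (intro continuous_intros assms(1) continuous_on_compose2[OF g(1)] continuous_on_ln_norm) auto
  show "K x * g (ln (norm x) - \<tau>) = 0" if "0 < x $ k" "\<not> (exp (\<tau> - \<epsilon>) \<le> norm x \<and> norm x \<le> exp (\<tau> + \<epsilon>))" for x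
    using annulus_of_ln_norm[OF half_space_imp_nonzero[OF that(1)] that(2)] g(2) by simp
qed simp

text \<open>
  Differentiation under the integral sign. Since \<open>g'\<close> is uniformly continuous, the remainder of the first-order
  expansion of \<open>g\<close> is \<open>o(h)\<close> uniformly, and it lives on a wider annulus.
\<close>

lemma DERIV_annular_average:
  fixes K :: "real ^ 'n::finite \<Rightarrow> real"
  assumes K: "continuous_on (punctured k) K"
    and deriv: "\<And>t. (g has_real_derivative g' t) (at t)" and g': "continuous_on UNIV g'"
    and supp: "\<And>t. \<bar>t\<bar> \<ge> \<epsilon> \<Longrightarrow> g t = 0" "\<And>t. \<bar>t\<bar> \<ge> \<epsilon> \<Longrightarrow> g' t = 0"
  shows "((\<lambda>\<tau>. LINT x:half_space k|lborel. K x * g (ln (norm x) - \<tau>)) has_real_derivative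
      - (LINT x:half_space k|lborel. K x * g' (ln (norm x) - \<tau>))) (at \<tau>)"
proof -
  have g: "continuous_on UNIV g"
    using deriv by (intro continuous_at_imp_continuous_on) (auto intro: DERIV_isCont)
  \<comment> \<open>A continuous majorant of the indicator of the interval that contains all shifts of the support
    by at most \<open>1\<close>.\<close>
  define w :: "real \<Rightarrow> real" where "w t = max 0 (\<epsilon> + 2 - \<bar>t\<bar>)" for t
  have w: "continuous_on UNIV w" "\<And>t. \<bar>t\<bar> \<ge> \<epsilon> + 2 \<Longrightarrow> w t = 0"
    unfolding w_def[abs_def] by (auto intro!: continuous_intros)
  define C where "C = (LINT x:half_space k|lborel. \<bar>K x\<bar> * w (ln (norm x) - \<tau>))"
  have C: "set_integrable lborel (half_space k) (\<lambda>x. \<bar>K x\<bar> * w (ln (norm x) - \<tau>))"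
    by (rule set_integrable_annular[OF _ w]) (intro continuous_intros K)
  have "C \<ge> 0"
    unfolding C_def set_lebesgue_integral_def by (intro Bochner_Integration.integral_nonneg) (auto simp: w_def)
  have bound: "\<bar>g (s - h) - g s + h * g' s\<bar> \<le> e * \<bar>h\<bar> * w s"
    if e: "e > 0" "\<bar>h\<bar> \<le> \<delta>" "\<delta> \<le> 1" "\<And>s t. \<bar>s - t\<bar> \<le> \<delta> \<Longrightarrow> \<bar>g' s - g' t\<bar> \<le> e" for e \<delta> s h
  proof (cases "\<bar>s\<bar> \<ge> \<epsilon> + 1")
    case True
    then have "\<bar>s - h\<bar> \<ge> \<epsilon>" "\<bar>s\<bar> \<ge> \<epsilon>" using e by linarith+
    with supp e show ?thesis by (simp add: w_def)
  next
    case False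
    have "norm ((g (s - h) - g' s * (s - h)) - (g s - g' s * s)) \<le> e * norm (s - h - s)"
    proof (rule field_differentiable_bound[where S = "cball s \<bar>h\<bar>" and f' = "\<lambda>t. g' t - g' s"])
      show "((\<lambda>t. g t - g' s * t) has_field_derivative g' t - g' s) (at t within cball s \<bar>h\<bar>)" for t
        by (rule derivative_eq_intros DERIV_subset[OF deriv] refl subset_UNIV | simp)+
      show "norm (g' t - g' s) \<le> e" if "t \<in> cball s \<bar>h\<bar>" for t
        using that e(4)[of t s] e(2) by (simp add: dist_real_def)
    qed (auto simp: dist_real_def)
    then have "\<bar>g (s - h) - g s + h * g' s\<bar> \<le> e * \<bar>h\<bar>" by (simp add: algebra_simps)
    also have "\<dots> \<le> e * \<bar>h\<bar> * w s"
      using e(1) False by (intro mult_left_mono[of 1 "w s" "e * \<bar>h\<bar>", simplified]) (auto simp: w_def)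
    finally show ?thesis .
  qed
  let ?W = "\<lambda>g \<tau>. LINT x:half_space k|lborel. K x * g (ln (norm x) - \<tau>)"
  have "(\<lambda>h. (?W g (\<tau> + h) - ?W g \<tau>) / h) \<midarrow>0\<rightarrow> - ?W g' \<tau>"
  proof (rule LIM_I)
    fix \<rho> :: real assume "\<rho> > 0"
    define e where "e = \<rho> / (C + 1)"
    have "e > 0" using \<open>\<rho> > 0\<close> \<open>C \<ge> 0\<close> by (simp add: e_def)
    obtain \<delta> where \<delta>: "\<delta> > 0" "\<And>s t. \<bar>s - t\<bar> < \<delta> \<Longrightarrow> \<bar>g' s - g' t\<bar> < e"
    proof -
      from compactly_supported_uniformly_continuous[OF g' supp(2)] \<open>e > 0\<close>
      obtain \<delta> where "\<delta> > 0" "\<forall>x\<in>UNIV. \<forall>x'\<in>UNIV. dist x' x < \<delta> \<longrightarrow> dist (g' x') (g' x) < e"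
        unfolding uniformly_continuous_on_def by blast
      with that[of \<delta>] show ?thesis by (simp add: dist_real_def)
    qed
    define \<delta>' where "\<delta>' = min (\<delta> / 2) 1"
    have \<delta>': "\<delta>' > 0" "\<delta>' \<le> 1" "\<And>s t. \<bar>s - t\<bar> \<le> \<delta>' \<Longrightarrow> \<bar>g' s - g' t\<bar> \<le> e"
      using \<delta>(1) by (auto simp: \<delta>'_def intro!: less_imp_le[OF \<delta>(2)])
    have "norm ((?W g (\<tau> + h) - ?W g \<tau>) / h - - ?W g' \<tau>) < \<rho>" if h: "h \<noteq> 0" "norm (h - 0) < \<delta>'" for h
    proof -
      have int: "set_integrable lborel (half_space k) (\<lambda>x. K x * g (ln (norm x) - (\<tau> + h)))"
        "set_integrable lborel (half_space k) (\<lambda>x. K x * g (ln (norm x) - \<tau>))"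
        "set_integrable lborel (half_space k) (\<lambda>x. K x * g' (ln (norm x) - \<tau>))"
        by (rule set_integrable_annular[OF K g supp(1)] set_integrable_annular[OF K g' supp(2)]; assumption)+
      let ?R = "\<lambda>x. K x * g (ln (norm x) - (\<tau> + h)) - K x * g (ln (norm x) - \<tau>) + h * (K x * g' (ln (norm x) - \<tau>))"
      have "?W g (\<tau> + h) - ?W g \<tau> + h * ?W g' \<tau> = (LINT x:half_space k|lborel. ?R x)"
        using int by (simp add: set_integral_add set_integral_diff)
      then have "\<bar>?W g (\<tau> + h) - ?W g \<tau> + h * ?W g' \<tau>\<bar> = \<bar>LINT x:half_space k|lborel. ?R x\<bar>"
        by (rule arg_cong[of _ _ abs])
      also have "\<dots> \<le> (LINT x:half_space k|lborel. \<bar>?R x\<bar>)"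
        by (rule set_integral_abs_bound)
      also have "\<dots> \<le> (LINT x:half_space k|lborel. (e * \<bar>h\<bar>) * (\<bar>K x\<bar> * w (ln (norm x) - \<tau>)))"
      proof (rule set_integral_mono)
        show "set_integrable lborel (half_space k) (\<lambda>x. \<bar>?R x\<bar>)"
          using int by (intro set_integrable_abs set_integral_add(1) set_integral_diff(1) set_integrable_mult_right)
        show "set_integrable lborel (half_space k) (\<lambda>x. e * \<bar>h\<bar> * (\<bar>K x\<bar> * w (ln (norm x) - \<tau>)))"
          by (intro set_integrable_mult_right C)
        fix x :: "real ^ 'n"
        have "?R x = K x * (g (ln (norm x) - \<tau> - h) - g (ln (norm x) - \<tau>) + h * g' (ln (norm x) - \<tau>))"
          by (simp add: algebra_simps)
        then have "\<bar>?R x\<bar> \<le> \<bar>K x\<bar> * (e * \<bar>h\<bar> * w (ln (norm x) - \<tau>))"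
          using bound[OF \<open>e > 0\<close> _ \<delta>'(2,3), of h "ln (norm x) - \<tau>"] h by (simp add: abs_mult mult_left_mono)
        then show "\<bar>?R x\<bar> \<le> e * \<bar>h\<bar> * (\<bar>K x\<bar> * w (ln (norm x) - \<tau>))" by (simp add: mult_ac)
      qed
      also have "\<dots> = e * \<bar>h\<bar> * C" unfolding C_def by (rule set_integral_mult_right)
      finally have "\<bar>?W g (\<tau> + h) - ?W g \<tau> + h * ?W g' \<tau>\<bar> \<le> e * \<bar>h\<bar> * C" .
      then have "\<bar>?W g (\<tau> + h) - ?W g \<tau> + h * ?W g' \<tau>\<bar> / \<bar>h\<bar> \<le> e * C"
        using h by (simp add: divide_le_eq mult_ac)
      moreover have "(?W g (\<tau> + h) - ?W g \<tau>) / h - - ?W g' \<tau> = (?W g (\<tau> + h) - ?W g \<tau> + h * ?W g' \<tau>) / h"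
        using h by (simp add: add_divide_distrib)
      ultimately have "norm ((?W g (\<tau> + h) - ?W g \<tau>) / h - - ?W g' \<tau>) \<le> e * C"
        by (simp add: abs_divide)
      also have "\<dots> < e * (C + 1)" using \<open>e > 0\<close> by simp
      also have "\<dots> = \<rho>" using \<open>C \<ge> 0\<close> by (simp add: e_def)
      finally show ?thesis .
    qed
    then show "\<exists>s>0. \<forall>h. h \<noteq> 0 \<and> norm (h - 0) < s \<longrightarrow> norm ((?W g (\<tau> + h) - ?W g \<tau>) / h - - ?W g' \<tau>) < \<rho>"
      using \<delta>'(1) by blast
  qed
  then show ?thesis unfolding DERIV_def .
qed

lemma continuous_on_comp_ln_norm:
  assumes "continuous_on UNIV g"
  shows "continuous_on (punctured k) (\<lambda>x. g (ln (norm x)))"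
  by (rule continuous_on_compose2[OF assms continuous_on_ln_norm]) simp

lemma continuous_on_sepfun:
  fixes a :: "real ^ 'n::finite"
  assumes g: "continuous_on UNIV g" "continuous_on UNIV g'" "continuous_on UNIV g''"
  shows "continuous_on (punctured k) (sepfun k a d g)"
    and "continuous_on (punctured k) (sepfun1 k a d g g' i)"
    and "continuous_on (punctured k) (sepfun2 k a d g g' g'' i)"
proof -
  note g = g[THEN continuous_on_comp_ln_norm[where k = k]]
  note ci = continuous_on_add continuous_on_mult continuous_on_diff continuous_on_divide
    continuous_on_power continuous_on_const continuous_on_component continuous_on_inner continuous_on_id g
  show "continuous_on (punctured k) (sepfun k a d g)"
    unfolding sepfun_def[abs_def] by (intro ci)
  show "continuous_on (punctured k) (sepfun1 k a d g g' i)"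
    unfolding sepfun1_def[abs_def] by (intro ci) auto
  show "continuous_on (punctured k) (sepfun2 k a d g g' g'' i)"
    unfolding sepfun2_def[abs_def] by (intro ci) auto
qed

section \<open>Angular moments of a positive solution\<close>

text \<open>
  The weight \<open>|x| powr (- n / 2 - 2)\<close> is the one for which the first-order term of the radial equation disappears.
  A moment is then an integral of \<open>u\<close> against \<open>x\<^sub>k\<close> times the \<open>d\<close>-th power of the angular variable
  \<open>a \<bullet> x / |x|\<close>, over an annulus around the sphere of radius \<open>exp \<tau>\<close>.
\<close>

definition moment_kernel :: "'n::finite \<Rightarrow> (real ^ 'n \<Rightarrow> real) \<Rightarrow> real ^ 'n \<Rightarrow> real" where
  "moment_kernel k u x = u x * x $ k / (x \<bullet> x) * exp (- (real CARD('n) / 2 * ln (norm x)))"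

definition moment :: "'n::finite \<Rightarrow> (real ^ 'n \<Rightarrow> real) \<Rightarrow> (real \<Rightarrow> real) \<Rightarrow> real ^ 'n \<Rightarrow> nat \<Rightarrow> real \<Rightarrow> real" where
  "moment k u g a d \<tau> = (LINT x:half_space k|lborel.
     moment_kernel k u x * (a \<bullet> x / norm x) ^ d * g (ln (norm x) - \<tau>))"

lemma continuous_on_moment_kernel:
  assumes "continuous_on (punctured k) u"
  shows "continuous_on (punctured k) (moment_kernel k u)"
  unfolding moment_kernel_def[abs_def]
  by (intro continuous_intros assms continuous_on_ln_norm) auto

lemma continuous_on_direction_power: "continuous_on (punctured k) (\<lambda>x. (a \<bullet> x / norm x) ^ d)"
  by (intro continuous_intros) auto

lemma DERIV_shifted_exp:
  assumes "\<And>t. (g has_real_derivative g' t) (at t)"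
  shows "((\<lambda>t. exp (- c * t) * g (t - \<tau>)) has_real_derivative exp (- c * t) * (g' (t - \<tau>) - c * g (t - \<tau>))) (at t)"
proof -
  have "((\<lambda>t. g (t - \<tau>)) has_real_derivative g' (t - \<tau>) * (1 - 0)) (at t)"
    by (rule DERIV_chain2[OF assms DERIV_diff[OF DERIV_ident DERIV_const]])
  from DERIV_mult[OF DERIV_chain2[OF DERIV_exp DERIV_cmult_Id[of "- c"]] this]
  show ?thesis by (simp add: algebra_simps)
qed

text \<open>
  The weak formulation for the test function \<open>x\<^sub>k (a \<bullet> x)\<^sup>d exp(- c ln |x|) bump \<epsilon> (ln |x| - \<tau>)\<close>. The exponent \<open>c = d + n / 2\<close>
  turns \<open>(a \<bullet> x)\<^sup>d\<close> into the power of the angular variable, up to the weight in \<open>moment_kernel\<close>, and it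
  removes the first derivative of the bump.
\<close>

lemma moment_identity:
  fixes a :: "real ^ 'n::finite" and k :: 'n and d :: nat
  assumes sol: "hardy_solution k \<gamma> u" and a: "a $ k = 0" and "\<epsilon> > 0"
  defines "c \<equiv> real d + real CARD('n) / 2"
  shows "moment k u (bump'' \<epsilon>) a d \<tau>
    = (c\<^sup>2 - \<gamma>) * moment k u (bump \<epsilon>) a d \<tau> - real (d * (d - 1)) * (a \<bullet> a) * moment k u (bump \<epsilon>) a (d - 2) \<tau>"
proof -
  define g where "g t = exp (- c * t) * bump \<epsilon> (t - \<tau>)" for t
  define g' where "g' t = exp (- c * t) * (bump' \<epsilon> (t - \<tau>) - c * bump \<epsilon> (t - \<tau>))" for t
  define g'' where "g'' t = exp (- c * t) * (bump'' \<epsilon> (t - \<tau>) - 2 * c * bump' \<epsilon> (t - \<tau>) + c\<^sup>2 * bump \<epsilon> (t - \<tau>))" for t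
  have g_deriv: "(g has_real_derivative g' t) (at t)" for t
    unfolding g_def[abs_def] g'_def by (rule DERIV_shifted_exp[OF DERIV_bump])
  have g'_deriv: "(g' has_real_derivative g'' t) (at t)" for t
  proof -
    have "((\<lambda>t. bump' \<epsilon> t - c * bump \<epsilon> t) has_real_derivative bump'' \<epsilon> t - c * bump' \<epsilon> t) (at t)" for t
      by (intro DERIV_diff DERIV_cmult DERIV_bump DERIV_bump')
    from DERIV_shifted_exp[OF this, of c \<tau> t] show ?thesis
      unfolding g'_def[abs_def] g''_def by (simp add: algebra_simps power2_eq_square)
  qed
  have shift: "continuous_on UNIV (\<lambda>t. f (t - \<tau>))" if "continuous_on UNIV f" for f :: "real \<Rightarrow> real"
    by (rule continuous_on_compose2[OF that]) (auto intro!: continuous_intros)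
  have g_cont: "continuous_on UNIV g" "continuous_on UNIV g'" "continuous_on UNIV g''"
    unfolding g_def[abs_def] g'_def[abs_def] g''_def[abs_def]
    by (intro continuous_intros shift continuous_bump)+
  note u = hardy_solutionD[OF sol]
  have supp: "g (ln (norm x)) = 0" "g' (ln (norm x)) = 0" "g'' (ln (norm x)) = 0"
    if "x \<noteq> 0" "\<not> (exp (\<tau> - \<epsilon>) \<le> norm x \<and> norm x \<le> exp (\<tau> + \<epsilon>))" for x :: "real ^ 'n"
    using bump_eq_0[OF \<open>\<epsilon> > 0\<close> annulus_of_ln_norm[OF that]] by (simp_all add: g_def g'_def g''_def)
  have weak: "(LINT x:half_space k|lborel.
      u x * ((\<Sum>i\<in>UNIV. sepfun2 k a d g g' g'' i x) + \<gamma> / (x \<bullet> x) * sepfun k a d g x)) = 0"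
  proof (rule weak_formulation[OF sol, of "exp (\<tau> - \<epsilon>)" _ "sepfun1 k a d g g'" _ "exp (\<tau> + \<epsilon>)"])
    show "sepfun k a d g x = 0 \<and> sepfun1 k a d g g' i x = 0 \<and> sepfun2 k a d g g' g'' i x = 0"
      if "x \<in> punctured k" "\<not> (exp (\<tau> - \<epsilon>) \<le> norm x \<and> norm x \<le> exp (\<tau> + \<epsilon>))" for x i
      using supp[of x] that by (simp add: sepfun_def sepfun1_def sepfun2_def)
    show "has_axis_deriv (sepfun k a d g) (sepfun1 k a d g g' i x) i x" if "0 < x $ k" for i x
      by (intro has_axis_deriv_sepfun half_space_imp_nonzero[OF that] g_deriv)
    show "has_axis_deriv (sepfun1 k a d g g' i) (sepfun2 k a d g g' g'' i x) i x" if "0 < x $ k" for i x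
      by (intro has_axis_deriv_sepfun1 half_space_imp_nonzero[OF that] g_deriv g'_deriv)
    show "sepfun k a d g x = 0" if "x $ k = 0" "x \<noteq> 0" for x
      using that by (simp add: sepfun_def)
  qed (simp_all add: continuous_on_sepfun[OF g_cont])
  let ?K = "\<lambda>d x. moment_kernel k u x * (a \<bullet> x / norm x) ^ d"
  have int: "set_integrable lborel (half_space k) (\<lambda>x. ?K d x * h (ln (norm x) - \<tau>))"
    if "h = bump \<epsilon> \<or> h = bump'' \<epsilon>" for d h
  proof (rule set_integrable_annular[where \<epsilon> = \<epsilon>])
    show "continuous_on (punctured k) (?K d)"
      by (intro continuous_on_mult continuous_on_moment_kernel u continuous_on_direction_power)
  qed (use that continuous_bump bump_eq_0[OF \<open>\<epsilon> > 0\<close>] in auto)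
  have "moment k u (bump'' \<epsilon>) a d \<tau> - (c\<^sup>2 - \<gamma>) * moment k u (bump \<epsilon>) a d \<tau>
      + real (d * (d - 1)) * (a \<bullet> a) * moment k u (bump \<epsilon>) a (d - 2) \<tau>
    = (LINT x:half_space k|lborel. ?K d x * bump'' \<epsilon> (ln (norm x) - \<tau>)
        - (c\<^sup>2 - \<gamma>) * (?K d x * bump \<epsilon> (ln (norm x) - \<tau>))
        + real (d * (d - 1)) * (a \<bullet> a) * (?K (d - 2) x * bump \<epsilon> (ln (norm x) - \<tau>)))"
    unfolding moment_def using int
    by (simp add: set_integral_add set_integral_diff set_integrable_mult_right)
  also have "\<dots> = (LINT x:half_space k|lborel.
      u x * ((\<Sum>i\<in>UNIV. sepfun2 k a d g g' g'' i x) + \<gamma> / (x \<bullet> x) * sepfun k a d g x))"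
  proof (rule set_lebesgue_integral_cong)
    show "\<forall>x. x \<in> half_space k \<longrightarrow> ?K d x * bump'' \<epsilon> (ln (norm x) - \<tau>)
        - (c\<^sup>2 - \<gamma>) * (?K d x * bump \<epsilon> (ln (norm x) - \<tau>))
        + real (d * (d - 1)) * (a \<bullet> a) * (?K (d - 2) x * bump \<epsilon> (ln (norm x) - \<tau>))
      = u x * ((\<Sum>i\<in>UNIV. sepfun2 k a d g g' g'' i x) + \<gamma> / (x \<bullet> x) * sepfun k a d g x)"
    proof (intro allI impI)
      fix x :: "real ^ 'n" assume "x \<in> half_space k"
      then have x: "x \<noteq> 0" by (auto dest: half_space_imp_nonzero)
      define t r A e e0 where "t = ln (norm x)" and "r = norm x" and "A = a \<bullet> x"
        and "e = exp (- c * t)" and "e0 = exp (- (real CARD('n) / 2 * t))"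
      have r: "r > 0" "x \<bullet> x = r\<^sup>2" using x by (simp_all add: r_def dot_square_norm)
      have "e0 = e * exp (real d * t)"
        by (simp add: e_def e0_def c_def mult_exp_exp algebra_simps)
      also have "exp (real d * t) = r ^ d"
        using r by (simp add: exp_of_nat_mult t_def r_def)
      finally have e0: "e0 = e * r ^ d" .
      have K: "moment_kernel k u x * (A / r) ^ d = u x * x $ k / r\<^sup>2 * (A ^ d * e)"
        unfolding moment_kernel_def t_def[symmetric] e0_def[symmetric] e0 power_divide using r by simp
      have K2: "real (d * (d - 1)) * (moment_kernel k u x * (A / r) ^ (d - 2))
          = real (d * (d - 1)) * (u x * x $ k * (A ^ (d - 2) * e))"
      proof (cases "d \<ge> 2")
        case True
        then have "r ^ d = r ^ (d - 2) * r\<^sup>2" by (metis le_add_diff_inverse2 power_add)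
        then show ?thesis
          unfolding moment_kernel_def t_def[symmetric] e0_def[symmetric] e0 power_divide using r by simp
      next
        case False
        then have "d = 0 \<or> d = 1" by auto
        then show ?thesis by auto
      qed
      let ?b = "bump \<epsilon> (t - \<tau>)" and ?b' = "bump' \<epsilon> (t - \<tau>)" and ?b'' = "bump'' \<epsilon> (t - \<tau>)"
      have g: "g t = e * ?b" "g'' t + (real CARD('n) + 2 * real d) * g' t = e * (?b'' - c\<^sup>2 * ?b)"
        by (simp_all add: g_def g'_def g''_def e_def c_def algebra_simps power2_eq_square)
      have "u x * ((\<Sum>i\<in>UNIV. sepfun2 k a d g g' g'' i x) + \<gamma> / (x \<bullet> x) * sepfun k a d g x)
          = u x * (x $ k * A ^ d / r\<^sup>2 * (e * (?b'' - c\<^sup>2 * ?b))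
              + real (d * (d - 1)) * (a \<bullet> a) * (x $ k * A ^ (d - 2) * (e * ?b))
              + \<gamma> / r\<^sup>2 * (x $ k * A ^ d * (e * ?b)))"
        unfolding sum_sepfun2[OF x a] sepfun_def t_def[symmetric] A_def[symmetric] r(2) g ..
      also have "\<dots> = (u x * x $ k / r\<^sup>2 * (A ^ d * e)) * (?b'' - (c\<^sup>2 - \<gamma>) * ?b)
          + (real (d * (d - 1)) * (u x * x $ k * (A ^ (d - 2) * e))) * ((a \<bullet> a) * ?b)"
        by (simp add: divide_inverse algebra_simps)
      also have "\<dots> = ?K d x * bump'' \<epsilon> (ln (norm x) - \<tau>)
        - (c\<^sup>2 - \<gamma>) * (?K d x * bump \<epsilon> (ln (norm x) - \<tau>))
        + real (d * (d - 1)) * (a \<bullet> a) * (?K (d - 2) x * bump \<epsilon> (ln (norm x) - \<tau>))"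
        unfolding K[symmetric] K2[symmetric] r_def[symmetric] A_def[symmetric]
        by (simp add: t_def r_def algebra_simps)
      finally show "?K d x * bump'' \<epsilon> (ln (norm x) - \<tau>)
        - (c\<^sup>2 - \<gamma>) * (?K d x * bump \<epsilon> (ln (norm x) - \<tau>))
        + real (d * (d - 1)) * (a \<bullet> a) * (?K (d - 2) x * bump \<epsilon> (ln (norm x) - \<tau>))
      = u x * ((\<Sum>i\<in>UNIV. sepfun2 k a d g g' g'' i x) + \<gamma> / (x \<bullet> x) * sepfun k a d g x)" ..
    qed
  qed simp
  finally show ?thesis using weak by simp
qed

lemma DERIV_moment:
  assumes sol: "hardy_solution k \<gamma> u" and "\<epsilon> > 0"
  shows "(moment k u (bump \<epsilon>) a d has_real_derivative - moment k u (bump' \<epsilon>) a d \<tau>) (at \<tau>)"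
    and "((\<lambda>\<tau>. - moment k u (bump' \<epsilon>) a d \<tau>) has_real_derivative moment k u (bump'' \<epsilon>) a d \<tau>) (at \<tau>)"
proof -
  have K: "continuous_on (punctured k) (\<lambda>x. moment_kernel k u x * (a \<bullet> x / norm x) ^ d)"
    by (intro continuous_on_mult continuous_on_moment_kernel hardy_solutionD(1)[OF sol] continuous_on_direction_power)
  show "(moment k u (bump \<epsilon>) a d has_real_derivative - moment k u (bump' \<epsilon>) a d \<tau>) (at \<tau>)"
    unfolding moment_def[abs_def]
    by (rule DERIV_annular_average[OF K DERIV_bump, where \<epsilon> = \<epsilon>])
       (auto intro: continuous_bump bump_eq_0[OF \<open>\<epsilon> > 0\<close>])
  have "(moment k u (bump' \<epsilon>) a d has_real_derivative - moment k u (bump'' \<epsilon>) a d \<tau>) (at \<tau>)"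
    unfolding moment_def[abs_def]
    by (rule DERIV_annular_average[OF K DERIV_bump', where \<epsilon> = \<epsilon>])
       (auto intro: continuous_bump bump_eq_0[OF \<open>\<epsilon> > 0\<close>])
  from DERIV_minus[OF this]
  show "((\<lambda>\<tau>. - moment k u (bump' \<epsilon>) a d \<tau>) has_real_derivative moment k u (bump'' \<epsilon>) a d \<tau>) (at \<tau>)"
    by simp
qed

lemma abs_moment_le:
  fixes a :: "real ^ 'n::finite"
  assumes sol: "hardy_solution k \<gamma> u" and "\<epsilon> > 0"
  shows "\<bar>moment k u (bump \<epsilon>) a d \<tau>\<bar> \<le> norm a ^ d * moment k u (bump \<epsilon>) a 0 \<tau>"
proof -
  note u = hardy_solutionD[OF sol]
  have int: "set_integrable lborel (half_space k)
      (\<lambda>x. moment_kernel k u x * (a \<bullet> x / norm x) ^ d * bump \<epsilon> (ln (norm x) - \<tau>))" for d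
    by (rule set_integrable_annular[where \<epsilon> = \<epsilon>])
       (intro continuous_on_mult continuous_on_moment_kernel u continuous_on_direction_power
          continuous_bump bump_eq_0 \<open>\<epsilon> > 0\<close>; assumption)+
  have "\<bar>moment k u (bump \<epsilon>) a d \<tau>\<bar>
      \<le> (LINT x:half_space k|lborel. \<bar>moment_kernel k u x * (a \<bullet> x / norm x) ^ d * bump \<epsilon> (ln (norm x) - \<tau>)\<bar>)"
    unfolding moment_def by (rule set_integral_abs_bound)
  also have "\<dots> \<le> (LINT x:half_space k|lborel.
      norm a ^ d * (moment_kernel k u x * (a \<bullet> x / norm x) ^ 0 * bump \<epsilon> (ln (norm x) - \<tau>)))"
  proof (rule set_integral_mono[OF set_integrable_abs[OF int] set_integrable_mult_right[OF int]])
    fix x :: "real ^ 'n" assume "x \<in> half_space k"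
    then have x: "0 < x $ k" "x \<noteq> 0" by (auto dest: half_space_imp_nonzero)
    have "\<bar>a \<bullet> x / norm x\<bar> \<le> norm a"
      using Cauchy_Schwarz_ineq2[of a x] x by (simp add: divide_le_eq)
    then have "\<bar>a \<bullet> x / norm x\<bar> ^ d \<le> norm a ^ d" by (intro power_mono) auto
    moreover have "moment_kernel k u x \<ge> 0"
      using u(2)[OF x(1)] x by (simp add: moment_kernel_def)
    ultimately show "\<bar>moment_kernel k u x * (a \<bullet> x / norm x) ^ d * bump \<epsilon> (ln (norm x) - \<tau>)\<bar>
        \<le> norm a ^ d * (moment_kernel k u x * (a \<bullet> x / norm x) ^ 0 * bump \<epsilon> (ln (norm x) - \<tau>))"
      using bump_nonneg[of \<epsilon> "ln (norm x) - \<tau>"]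
      by (simp add: abs_mult power_abs mult.assoc mult.left_commute[of "moment_kernel k u x"] mult_right_mono)
  qed
  also have "\<dots> = norm a ^ d * moment k u (bump \<epsilon>) a 0 \<tau>"
    unfolding moment_def by (rule set_integral_mult_right)
  finally show ?thesis .
qed

text \<open>
  The quotient of the integrals of \<open>x\<^sub>k\<^sup>2 (a \<bullet> x)\<^sup>d\<close> and of \<open>x\<^sub>k\<^sup>2\<close> over the unit sphere, where \<open>q = a \<bullet> a\<close>
  and \<open>a\<close> is orthogonal to the \<open>k\<close>-axis.
\<close>

fun angular_moment :: "real \<Rightarrow> real \<Rightarrow> nat \<Rightarrow> real" where
  "angular_moment n q 0 = 1"
| "angular_moment n q (Suc 0) = 0"
| "angular_moment n q (Suc (Suc d)) = real (Suc d) * q / (real (Suc (Suc d)) + n) * angular_moment n q d"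

text \<open>
  The heart of the argument. The function \<open>\<tau> \<mapsto> moment k u (bump \<epsilon>) a 0 \<tau>\<close> solves \<open>M'' = b\<^sup>2 M\<close>. By induction, subtracting the right
  multiple of it from the \<open>d\<close>-th moment leaves a solution of \<open>Z'' = a\<^sub>d\<^sup>2 Z\<close> with \<open>a\<^sub>d > b\<close>. As \<open>u\<close> is positive,
  the \<open>d\<close>-th moment is dominated by the one of order \<open>0\<close>, so \<open>Z\<close> grows more slowly
  than any nonzero solution of its equation can, and \<open>Z = 0\<close>. The factor of proportionality depends
  neither on \<open>u\<close> nor on the annulus.
\<close>

lemma moment_proportional:
  fixes a :: "real ^ 'n::finite" and k :: 'n
  assumes sol: "hardy_solution k \<gamma> u" and a: "a $ k = 0" and \<epsilon>: "\<epsilon> > 0"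
    and \<gamma>: "\<gamma> < (real CARD('n))\<^sup>2 / 4"
  shows "moment k u (bump \<epsilon>) a d \<tau>
    = angular_moment (real CARD('n)) (a \<bullet> a) d * moment k u (bump \<epsilon>) a 0 \<tau>"
proof -
  let ?n = "real CARD('n)"
  let ?M = "moment k u (bump \<epsilon>) a"
  define b where "b = sqrt (?n\<^sup>2 / 4 - \<gamma>)"
  have b: "b > 0" "b\<^sup>2 = ?n\<^sup>2 / 4 - \<gamma>" using \<gamma> by (simp_all add: b_def)
  have M0'': "moment k u (bump'' \<epsilon>) a 0 \<tau> = b\<^sup>2 * ?M 0 \<tau>" for \<tau>
    using moment_identity[OF sol a \<epsilon>, of 0 \<tau>] by (simp add: b power_divide)
  obtain A0 B0 where M0: "\<And>\<tau>. ?M 0 \<tau> = A0 * exp (b * \<tau>) + B0 * exp (- b * \<tau>)"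
    by (rule exponential_solutions[OF b(1) DERIV_moment[OF sol \<epsilon>] M0'']) (rule that)
  have step: "?M d \<tau> = C * ?M 0 \<tau>"
    if d: "d \<ge> 1" and C: "C * (real d * (real d + ?n)) = P"
      and IH: "\<And>\<tau>. real (d * (d - 1)) * (a \<bullet> a) * ?M (d - 2) \<tau> = P * ?M 0 \<tau>" for d C P \<tau>
  proof -
    \<comment> \<open>\<open>al\<close> is the exponent \<open>a\<^sub>d\<close> of the mode of degree \<open>d\<close>.\<close>
    define al where "al = sqrt ((real d + ?n / 2)\<^sup>2 - \<gamma>)"
    have eq: "(real d + ?n / 2)\<^sup>2 - \<gamma> = b\<^sup>2 + real d * (real d + ?n)"
      unfolding b by (simp add: power2_eq_square algebra_simps)
    have pos: "real d * (real d + ?n) > 0" using d by (simp add: add_pos_nonneg)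
    then have "(real d + ?n / 2)\<^sup>2 - \<gamma> \<ge> 0" unfolding eq by (intro add_nonneg_nonneg) auto
    then have al2: "al\<^sup>2 = (real d + ?n / 2)\<^sup>2 - \<gamma>" and "al \<ge> 0" unfolding al_def by simp_all
    have al2_b: "al\<^sup>2 - b\<^sup>2 = real d * (real d + ?n)" "b\<^sup>2 < al\<^sup>2" using al2 eq pos by linarith+
    have "al > b" using al2_b(2) \<open>al \<ge> 0\<close> by (rule power2_less_imp_less)
    then have al: "al > 0" "\<bar>b\<bar> < al" using b by auto
    define Z where "Z \<tau> = ?M d \<tau> - C * ?M 0 \<tau>" for \<tau>
    obtain A B where Z: "\<And>\<tau>. Z \<tau> = A * exp (al * \<tau>) + B * exp (- al * \<tau>)"
    proof (rule exponential_solutions[OF al(1)])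
      show "(Z has_real_derivative - moment k u (bump' \<epsilon>) a d \<tau> - C * - moment k u (bump' \<epsilon>) a 0 \<tau>) (at \<tau>)" for \<tau>
        unfolding Z_def[abs_def] by (intro DERIV_diff DERIV_cmult DERIV_moment[OF sol \<epsilon>])
      show "((\<lambda>\<tau>. - moment k u (bump' \<epsilon>) a d \<tau> - C * - moment k u (bump' \<epsilon>) a 0 \<tau>) has_real_derivative
          moment k u (bump'' \<epsilon>) a d \<tau> - C * moment k u (bump'' \<epsilon>) a 0 \<tau>) (at \<tau>)" for \<tau>
        by (intro DERIV_diff DERIV_cmult DERIV_moment[OF sol \<epsilon>])
      show "moment k u (bump'' \<epsilon>) a d \<tau> - C * moment k u (bump'' \<epsilon>) a 0 \<tau> = al\<^sup>2 * Z \<tau>" for \<tau>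
      proof -
        have "P = C * (al\<^sup>2 - b\<^sup>2)" using C al2_b by simp
        then show ?thesis
          unfolding M0'' Z_def moment_identity[OF sol a \<epsilon>, of d \<tau>] IH al2[symmetric] \<open>P = _\<close>
          by (simp add: algebra_simps)
      qed
    qed (rule that)
    have "\<bar>A * exp (al * \<tau>) + B * exp (- al * \<tau>)\<bar>
        \<le> ((norm a ^ d + \<bar>C\<bar>) * A0) * exp (b * \<tau>) + ((norm a ^ d + \<bar>C\<bar>) * B0) * exp (- b * \<tau>)" for \<tau>
    proof -
      have "?M 0 \<tau> \<ge> 0" using abs_moment_le[OF sol \<epsilon>, of a 0 \<tau>] by simp
      then have "\<bar>Z \<tau>\<bar> \<le> norm a ^ d * ?M 0 \<tau> + \<bar>C\<bar> * ?M 0 \<tau>"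
        using abs_moment_le[OF sol \<epsilon>, of a d \<tau>] unfolding Z_def
        by (intro order_trans[OF abs_triangle_ineq4]) (simp add: abs_mult)
      also have "\<dots> = (norm a ^ d + \<bar>C\<bar>) * (A0 * exp (b * \<tau>) + B0 * exp (- b * \<tau>))"
        unfolding M0 by (simp add: algebra_simps)
      finally show ?thesis unfolding Z by (simp add: algebra_simps)
    qed
    from exponentials_eq_0_of_slower_growth[OF al(2) this] Z have "Z \<tau> = 0" by simp
    then show ?thesis by (simp add: Z_def)
  qed
  show ?thesis
  proof (induction d arbitrary: \<tau> rule: induct_nat_012)
    case 0
    then show ?case by simp
  next
    case 1
    then show ?case using step[of 1 0 0] by simp
  next
    case (ge2 d)
    let ?d = "Suc (Suc d)"
    have "?M ?d \<tau> = (real (Suc d) * (a \<bullet> a) / (real ?d + ?n) * angular_moment ?n (a \<bullet> a) d) * ?M 0 \<tau>"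
    proof (rule step[where P = "real (?d * (?d - 1)) * (a \<bullet> a) * angular_moment ?n (a \<bullet> a) d"])
      have "real ?d + ?n \<noteq> 0" by simp
      then show "real (Suc d) * (a \<bullet> a) / (real ?d + ?n) * angular_moment ?n (a \<bullet> a) d * (real ?d * (real ?d + ?n))
          = real (?d * (?d - 1)) * (a \<bullet> a) * angular_moment ?n (a \<bullet> a) d"
        by (simp only: diff_Suc_1 of_nat_mult) (simp add: divide_simps mult_ac)
    qed (simp_all add: ge2.IH(1))
    then show ?case by simp
  qed
qed

section \<open>Density on the closed half-sphere\<close>

definition half_sphere :: "'n::finite \<Rightarrow> (real ^ 'n) set" where
  "half_sphere k = {y. norm y = 1 \<and> 0 \<le> y $ k}"

lemma compact_half_sphere: "compact (half_sphere k)"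
  using compact_half_annulus[of k 1 1] unfolding half_sphere_def
  by (rule back_subst[where P = compact]) auto

lemma sgn_in_half_sphere: "0 < x $ k \<Longrightarrow> sgn x \<in> half_sphere k"
  using half_space_imp_nonzero[of x k] by (simp add: half_sphere_def norm_sgn sgn_div_norm)

lemma set_integrable_mult_direction:
  fixes h f :: "real ^ 'n::finite \<Rightarrow> real"
  assumes h: "set_integrable lborel (half_space k) h" and f: "continuous_on (half_sphere k) f"
  shows "set_integrable lborel (half_space k) (\<lambda>x. h x * f (sgn x))"
proof -
  obtain B where B: "\<And>y. y \<in> half_sphere k \<Longrightarrow> \<bar>f y\<bar> \<le> B"
    using compact_imp_bounded[OF compact_continuous_image[OF f compact_half_sphere]]
    unfolding bounded_iff by auto
  show ?thesis
  proof (rule set_integrable_bound)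
    show "set_integrable lborel (half_space k) (\<lambda>x. B * h x)" using h by simp
    have "continuous_on (half_space k) (\<lambda>x. f (sgn x))"
      by (rule continuous_on_compose2[OF f])
         (auto intro!: continuous_intros sgn_in_half_sphere dest: half_space_imp_nonzero)
    then have "(\<lambda>x. indicator (half_space k) x *\<^sub>R f (sgn x)) \<in> borel_measurable borel"
      by (intro borel_measurable_continuous_on_indicator) simp_all
    moreover have "(\<lambda>x. indicator (half_space k) x *\<^sub>R h x) \<in> borel_measurable borel"
      using h unfolding set_integrable_def by (auto dest: borel_measurable_integrable)
    ultimately have "(\<lambda>x. (indicator (half_space k) x *\<^sub>R h x) * (indicator (half_space k) x *\<^sub>R f (sgn x)))
        \<in> borel_measurable borel" by (intro borel_measurable_times)
    also have "(\<lambda>x. (indicator (half_space k) x *\<^sub>R h x) * (indicator (half_space k) x *\<^sub>R f (sgn x)))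
        = (\<lambda>x. indicator (half_space k) x *\<^sub>R (h x * f (sgn x)))"
      by (auto simp: fun_eq_iff indicator_def)
    finally show "set_borel_measurable lborel (half_space k) (\<lambda>x. h x * f (sgn x))"
      unfolding set_borel_measurable_def by simp
    show "AE x in lborel. x \<in> half_space k \<longrightarrow> norm (h x * f (sgn x)) \<le> norm (B * h x)"
    proof (intro AE_I2 impI)
      fix x :: "real ^ 'n" assume "x \<in> half_space k"
      then have "\<bar>f (sgn x)\<bar> \<le> \<bar>B\<bar>" using B[OF sgn_in_half_sphere] by fastforce
      then show "norm (h x * f (sgn x)) \<le> norm (B * h x)"
        by (simp only: real_norm_def abs_mult mult.commute[of "\<bar>h x\<bar>"]) (rule mult_right_mono, auto)
    qed
  qed
qed

text \<open>
  Sums of exponentials of linear forms in the coordinates other than \<open>k\<close>. They form an algebra, and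
  on the half-sphere they separate points, since there the missing coordinate is a nonnegative square root of a
  function of the others.
\<close>

inductive exp_sum :: "'n::finite \<Rightarrow> (real ^ 'n \<Rightarrow> real) \<Rightarrow> bool" for k where
  exp: "a $ k = 0 \<Longrightarrow> exp_sum k (\<lambda>y. c * exp (a \<bullet> y))"
| add: "exp_sum k f \<Longrightarrow> exp_sum k g \<Longrightarrow> exp_sum k (\<lambda>y. f y + g y)"

lemma exp_sum_mult:
  assumes "exp_sum k f" "exp_sum k g" shows "exp_sum k (\<lambda>y. f y * g y)"
  using assms
proof (induction rule: exp_sum.induct)
  case (exp a c)
  from exp(2,1) show ?case
  proof (induction rule: exp_sum.induct)
    case (exp b e)
    then have "exp_sum k (\<lambda>y. (c * e) * exp ((a + b) \<bullet> y))" by (intro exp_sum.exp) simp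
    then show ?case by (simp add: inner_add_left exp_add mult_ac)
  next
    case (add f g)
    then show ?case using exp_sum.add by (simp add: distrib_left)
  qed
next
  case (add f g)
  then show ?case using exp_sum.add by (simp add: distrib_right)
qed

lemma exp_sum_dense:
  assumes "continuous_on (half_sphere k) f" "e > 0"
  shows "\<exists>g. exp_sum k g \<and> (\<forall>y\<in>half_sphere k. \<bar>f y - g y\<bar> < e)"
proof (rule Stone_Weierstrass_HOL)
  show "exp_sum k (\<lambda>x. c)" for c using exp_sum.exp[of 0 k c] by simp
  show "continuous_on (half_sphere k) g" if "exp_sum k g" for g
    using that by induction (intro continuous_intros; assumption)+
  show "\<exists>g. exp_sum k g \<and> g x \<noteq> g y"
    if xy: "x \<in> half_sphere k \<and> y \<in> half_sphere k \<and> x \<noteq> y" for x y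
  proof -
    have "\<exists>i. i \<noteq> k \<and> x $ i \<noteq> y $ i"
    proof (rule ccontr)
      assume "\<nexists>i. i \<noteq> k \<and> x $ i \<noteq> y $ i"
      then have eq: "x $ i = y $ i" if "i \<noteq> k" for i using that by blast
      have "(\<Sum>i\<in>UNIV. (x $ i)\<^sup>2) = (\<Sum>i\<in>UNIV. (y $ i)\<^sup>2)"
        using xy by (simp add: half_sphere_def inner_self_vec[symmetric] dot_square_norm)
      then have "(x $ k)\<^sup>2 = (y $ k)\<^sup>2"
        by (simp add: sum.remove[of UNIV k] eq)
      then have "x $ k = y $ k" using xy by (simp add: half_sphere_def)
      with eq have "x = y" by (metis vec_eq_iff)
      with xy show False by simp
    qed
    then obtain i where i: "i \<noteq> k" "x $ i \<noteq> y $ i" by blast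
    have "exp_sum k (\<lambda>y. 1 * exp (axis i 1 \<bullet> y))"
      by (rule exp_sum.exp) (use i in \<open>simp add: axis_def\<close>)
    moreover have "1 * exp (axis i 1 \<bullet> x) \<noteq> 1 * exp (axis i 1 \<bullet> y)"
      using i by (simp add: inner_axis')
    ultimately show ?thesis by blast
  qed
qed (use assms in \<open>auto intro: compact_half_sphere exp_sum.add exp_sum_mult\<close>)

text \<open>
  Powers of \<open>a \<bullet> y\<close> approximate the plane wave \<open>exp (a \<bullet> y)\<close> uniformly, and sums of plane waves approximate
  every continuous function on the half-sphere.
\<close>

lemma angular_moments_determine:
  fixes h :: "real ^ 'n::finite \<Rightarrow> real"
  assumes h: "set_integrable lborel (half_space k) h"
    and moments: "\<And>a d. a $ k = 0 \<Longrightarrow> (LINT x:half_space k|lborel. h x * (a \<bullet> sgn x) ^ d) = 0"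
    and f: "continuous_on (half_sphere k) f"
  shows "(LINT x:half_space k|lborel. h x * f (sgn x)) = 0"
proof -
  let ?I = "\<lambda>f. LINT x:half_space k|lborel. h x * f (sgn x)"
  note int = set_integrable_mult_direction[OF h]
  define C where "C = (LINT x:half_space k|lborel. \<bar>h x\<bar>)"
  have "C \<ge> 0"
    unfolding C_def set_lebesgue_integral_def by (intro Bochner_Integration.integral_nonneg) auto
  have approx: "?I f = 0"
    if f: "continuous_on (half_sphere k) f"
      and ex: "\<And>e. e > 0 \<Longrightarrow> \<exists>g. continuous_on (half_sphere k) g \<and> ?I g = 0 \<and> (\<forall>y\<in>half_sphere k. \<bar>f y - g y\<bar> < e)"
    for f
  proof -
    have "\<bar>?I f\<bar> \<le> 0 + e" if "e > 0" for e
    proof -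
      have "e / (C + 1) > 0" using that \<open>C \<ge> 0\<close> by simp
      from ex[OF this] obtain g where g: "continuous_on (half_sphere k) g" "?I g = 0"
        "\<And>y. y \<in> half_sphere k \<Longrightarrow> \<bar>f y - g y\<bar> < e / (C + 1)" by blast
      have "?I f = (LINT x:half_space k|lborel. h x * f (sgn x) - h x * g (sgn x))"
        using g(2) int[OF f] int[OF g(1)] by (simp add: set_integral_diff)
      then have "\<bar>?I f\<bar> = \<bar>LINT x:half_space k|lborel. h x * f (sgn x) - h x * g (sgn x)\<bar>"
        by (rule arg_cong[of _ _ abs])
      also have "\<dots> \<le> (LINT x:half_space k|lborel. \<bar>h x * f (sgn x) - h x * g (sgn x)\<bar>)"
        by (rule set_integral_abs_bound)
      also have "\<dots> \<le> (LINT x:half_space k|lborel. (e / (C + 1)) * \<bar>h x\<bar>)"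
      proof (rule set_integral_mono)
        show "set_integrable lborel (half_space k) (\<lambda>x. \<bar>h x * f (sgn x) - h x * g (sgn x)\<bar>)"
          by (intro set_integrable_abs set_integral_diff(1) int f g)
        show "set_integrable lborel (half_space k) (\<lambda>x. e / (C + 1) * \<bar>h x\<bar>)"
          by (intro set_integrable_mult_right set_integrable_abs h)
        fix x :: "real ^ 'n" assume "x \<in> half_space k"
        then have "\<bar>f (sgn x) - g (sgn x)\<bar> \<le> e / (C + 1)"
          by (intro less_imp_le g(3) sgn_in_half_sphere) simp
        then show "\<bar>h x * f (sgn x) - h x * g (sgn x)\<bar> \<le> e / (C + 1) * \<bar>h x\<bar>"
          by (simp only: right_diff_distrib[symmetric] abs_mult mult.commute[of "\<bar>h x\<bar>"]) (rule mult_right_mono, auto)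
      qed
      also have "\<dots> = e / (C + 1) * C" unfolding C_def by (rule set_integral_mult_right)
      also have "\<dots> \<le> e" using that \<open>C \<ge> 0\<close> by (simp add: field_simps)
      finally show ?thesis by simp
    qed
    then have "\<bar>?I f\<bar> \<le> 0" by (rule field_le_epsilon)
    then show ?thesis by simp
  qed
  have plane: "?I (\<lambda>y. \<phi> (a \<bullet> y)) = 0" if a: "a $ k = 0" and \<phi>: "continuous_on UNIV \<phi>" for a and \<phi> :: "real \<Rightarrow> real"
  proof (rule approx)
    show "continuous_on (half_sphere k) (\<lambda>y. \<phi> (a \<bullet> y))"
      by (rule continuous_on_compose2[OF \<phi>]) (auto intro!: continuous_intros)
    fix e :: real assume "e > 0"
    then obtain p where p: "real_polynomial_function p" "\<And>t. t \<in> {- norm a..norm a} \<Longrightarrow> \<bar>\<phi> t - p t\<bar> < e"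
      using Stone_Weierstrass_real_polynomial_function[of "{- norm a..norm a}" \<phi> e]
        continuous_on_subset[OF \<phi>] by auto
    then obtain c m where pc: "p = (\<lambda>t. \<Sum>i\<le>m. c i * t ^ i)"
      using real_polynomial_function_iff_sum by blast
    have cont: "continuous_on (half_sphere k) (\<lambda>y. (a \<bullet> y) ^ i)" for i
      by (intro continuous_intros)
    have "?I (\<lambda>y. \<Sum>i\<le>m. c i * (a \<bullet> y) ^ i) = (LINT x|lborel. (\<Sum>i\<le>m. c i * (indicator (half_space k) x *\<^sub>R (h x * (a \<bullet> sgn x) ^ i))))"
      unfolding set_lebesgue_integral_def
      by (intro Bochner_Integration.integral_cong refl) (simp add: sum_distrib_left mult_ac)
    also have "\<dots> = (\<Sum>i\<le>m. c i * (LINT x:half_space k|lborel. h x * (a \<bullet> sgn x) ^ i))"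
      using int[OF cont] unfolding set_lebesgue_integral_def set_integrable_def
      by (subst Bochner_Integration.integral_sum) auto
    also have "\<dots> = 0" using moments[OF a] by simp
    finally have "?I (\<lambda>y. p (a \<bullet> y)) = 0" unfolding pc .
    moreover have "continuous_on (half_sphere k) (\<lambda>y. p (a \<bullet> y))"
      unfolding pc by (intro continuous_intros)
    moreover have "\<bar>\<phi> (a \<bullet> y) - p (a \<bullet> y)\<bar> < e" if "y \<in> half_sphere k" for y
      using Cauchy_Schwarz_ineq2[of a y] that by (intro p(2)) (auto simp: half_sphere_def abs_le_iff)
    ultimately show "\<exists>g. continuous_on (half_sphere k) g \<and> ?I g = 0 \<and> (\<forall>y\<in>half_sphere k. \<bar>\<phi> (a \<bullet> y) - g y\<bar> < e)"
      by blast
  qed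
  have exps: "continuous_on (half_sphere k) g \<and> ?I g = 0" if "exp_sum k g" for g
    using that
  proof induction
    case (exp a c)
    have "?I (\<lambda>y. c * exp (a \<bullet> y)) = c * ?I (\<lambda>y. exp (a \<bullet> y))"
      by (simp add: mult.left_commute)
    then show ?case
      using plane[OF exp continuous_on_exp[OF continuous_on_id]] by (auto intro!: continuous_intros)
  next
    case (add f g)
    then have "?I (\<lambda>y. f y + g y) = ?I f + ?I g"
      using int[of f] int[of g] by (simp add: distrib_left set_integral_add)
    with add show ?case by (auto intro!: continuous_intros)
  qed
  show ?thesis
  proof (rule approx[OF f])
    fix e :: real assume "e > 0"
    from exp_sum_dense[OF f this]
    show "\<exists>g. continuous_on (half_sphere k) g \<and> ?I g = 0 \<and> (\<forall>y\<in>half_sphere k. \<bar>f y - g y\<bar> < e)"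
      using exps by blast
  qed
qed

text \<open>
  A nonempty open set is not negligible.
\<close>

lemma set_integral_pos:
  fixes f :: "real ^ 'n::finite \<Rightarrow> real"
  assumes int: "set_integrable lborel (half_space k) f" and cont: "continuous_on (half_space k) f"
    and nonneg: "\<And>x. 0 < x $ k \<Longrightarrow> 0 \<le> f x" and z: "0 < z $ k" "0 < f z"
  shows "0 < (LINT x:half_space k|lborel. f x)"
proof (rule ccontr)
  let ?f = "\<lambda>x. indicator (half_space k) x *\<^sub>R f x"
  have nn: "0 \<le> ?f x" for x using nonneg[of x] by (auto simp: indicator_def)
  assume "\<not> ?thesis"
  moreover have "0 \<le> integral\<^sup>L lborel ?f" using nn by (intro Bochner_Integration.integral_nonneg) auto
  ultimately have "integral\<^sup>L lborel ?f = 0" by (simp add: set_lebesgue_integral_def)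
  then have "AE x in lborel. ?f x = 0"
    using integral_nonneg_eq_0_iff_AE[of lborel ?f] int nn unfolding set_integrable_def by simp
  then obtain N where N: "N \<in> null_sets lborel" "{x. ?f x \<noteq> 0} \<subseteq> N"
    by (auto elim!: AE_E simp: null_sets_def)
  let ?O = "{x \<in> half_space k. f x \<in> {0<..}}"
  have "?O \<subseteq> N" using N(2) by auto
  moreover have "negligible N" using N(1) by (simp add: negligible_iff_null_sets null_sets_completionI)
  ultimately have "negligible ?O" using negligible_subset by blast
  moreover have "open ?O"
    using continuous_open_preimage[OF cont open_half_space, of "{0<..}"]
    by (rule back_subst[where P = "open"]) auto
  moreover have "z \<in> ?O" using z by simp
  ultimately show False using open_not_negligible by blast
qed

section \<open>Two positive solutions have a radial quotient\<close>

lemma set_integrable_moment_kernel_bump: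
  assumes "hardy_solution k \<gamma> u" "\<epsilon> > 0"
  shows "set_integrable lborel (half_space k) (\<lambda>x. moment_kernel k u x * bump \<epsilon> (ln (norm x) - \<tau>))"
  by (rule set_integrable_annular[where \<epsilon> = \<epsilon>])
     (auto intro: continuous_on_moment_kernel hardy_solutionD(1)[OF assms(1)] continuous_bump bump_eq_0 assms(2))

lemma continuous_on_moment_kernel_bump:
  assumes "hardy_solution k \<gamma> u"
  shows "continuous_on (half_space k) (\<lambda>x. moment_kernel k u x * bump \<epsilon> (ln (norm x) - \<tau>))"
proof (rule continuous_on_subset[where s = "punctured k"])
  show "continuous_on (punctured k) (\<lambda>x. moment_kernel k u x * bump \<epsilon> (ln (norm x) - \<tau>))"
    by (intro continuous_on_mult continuous_on_moment_kernel hardy_solutionD(1)[OF assms]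
        continuous_on_compose2[OF continuous_bump(1)]
        continuous_on_diff continuous_on_ln_norm continuous_on_const) auto
qed (auto dest: half_space_imp_nonzero)

lemma continuous_on_cone_bump:
  "continuous_on (half_sphere k) (\<lambda>y. max 0 (\<delta> - dist y (z :: real ^ 'n::finite)))"
  by (intro continuous_intros)

lemma moment_0_pos:
  fixes k :: "'n::finite"
  assumes sol: "hardy_solution k \<gamma> u" and \<epsilon>: "\<epsilon> > 0"
  shows "moment k u (bump \<epsilon>) 0 0 \<tau> > 0"
proof -
  note u = hardy_solutionD[OF sol]
  let ?z = "exp \<tau> *\<^sub>R axis k (1::real)"
  let ?h = "\<lambda>x. moment_kernel k u x * bump \<epsilon> (ln (norm x) - \<tau>)"
  have "0 < (LINT x:half_space k|lborel. ?h x)"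
  proof (rule set_integral_pos[where z = ?z])
    show "set_integrable lborel (half_space k) ?h"
      by (rule set_integrable_moment_kernel_bump[OF sol \<epsilon>])
    show "continuous_on (half_space k) ?h"
      by (rule continuous_on_moment_kernel_bump[OF sol])
    show "0 \<le> ?h x" if "0 < x $ k" for x
      using u(2)[OF that] that bump_nonneg by (simp add: moment_kernel_def)
    show z: "0 < ?z $ k" by (simp add: axis_def)
    have "norm ?z = exp \<tau>" by simp
    then show "0 < ?h ?z"
      using u(2)[OF z] z half_space_imp_nonzero[OF z] bump_pos[OF \<epsilon>, of 0] \<epsilon>
      unfolding moment_kernel_def by (simp only: \<open>norm ?z = exp \<tau>\<close> ln_exp diff_self) simp
  qed
  then show ?thesis by (simp add: moment_def)
qed

text \<open>
  Let \<open>\<kappa>\<close> be the quotient of the two moments of order \<open>0\<close>. All moments of \<open>u\<close> and \<open>v\<close> stand in the same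
  proportion, so on the annulus \<open>u - \<kappa> v\<close> is orthogonal to every continuous function of the
  direction, in particular to a bump around \<open>sgn z\<close>. Hence \<open>u - \<kappa> v\<close> is not positive throughout the
  region near \<open>z\<close>, whereas \<open>u - K v\<close> is; so \<open>K < \<kappa>\<close>.
\<close>

lemma moment_ratio_gt:
  fixes k :: "'n::finite"
  assumes u: "hardy_solution k \<gamma> u" and v: "hardy_solution k \<gamma> v"
    and \<gamma>: "\<gamma> < (real CARD('n))\<^sup>2 / 4"
    and z: "0 < z $ k" and \<epsilon>: "0 < \<epsilon>" "\<epsilon> \<le> \<delta>"
    and less: "\<And>w. 0 < w $ k \<Longrightarrow> dist (sgn w) (sgn z) < \<delta> \<Longrightarrow> \<bar>ln (norm w) - ln (norm z)\<bar> < \<delta> \<Longrightarrow> K * v w < u w"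
  shows "K * moment k v (bump \<epsilon>) 0 0 (ln (norm z)) < moment k u (bump \<epsilon>) 0 0 (ln (norm z))"
proof (rule ccontr)
  define \<tau> where "\<tau> = ln (norm z)"
  let ?M = "\<lambda>u. moment k u (bump \<epsilon>) 0 0 \<tau>"
  define \<kappa> where "\<kappa> = ?M u / ?M v"
  have M: "?M v > 0" "?M u > 0" using moment_0_pos[OF v \<epsilon>(1)] moment_0_pos[OF u \<epsilon>(1)] by auto
  assume "\<not> ?thesis"
  then have "\<kappa> \<le> K" using M by (simp add: \<kappa>_def \<tau>_def divide_le_eq)
  let ?h = "\<lambda>u x. moment_kernel k u x * bump \<epsilon> (ln (norm x) - \<tau>)"
  let ?D = "\<lambda>x. ?h u x - \<kappa> * ?h v x"
  note h_int = set_integrable_moment_kernel_bump[where \<gamma> = \<gamma>, OF _ \<epsilon>(1)]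
    and h_cont = continuous_on_moment_kernel_bump[where \<gamma> = \<gamma>]
  have D_int: "set_integrable lborel (half_space k) ?D"
    by (intro set_integral_diff(1) set_integrable_mult_right h_int u v)
  let ?f = "\<lambda>y. max 0 (\<delta> - dist y (sgn z))"
  have "(LINT x:half_space k|lborel. ?D x * ?f (sgn x)) = 0"
  proof (rule angular_moments_determine[OF D_int _ continuous_on_cone_bump])
    fix a :: "real ^ 'n" and d assume a: "a $ k = 0"
    have dir: "a \<bullet> sgn x = a \<bullet> x / norm x" for x
      by (simp add: sgn_div_norm divide_inverse mult.commute)
    have eq: "(LINT x:half_space k|lborel. ?h u x * (a \<bullet> sgn x) ^ d)
        = angular_moment (real CARD('n)) (a \<bullet> a) d * ?M u" if "hardy_solution k \<gamma> u" for u
    proof -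
      have "(LINT x:half_space k|lborel. ?h u x * (a \<bullet> sgn x) ^ d) = moment k u (bump \<epsilon>) a d \<tau>"
        unfolding moment_def by (rule set_lebesgue_integral_cong) (auto simp: dir mult_ac)
      also have "\<dots> = angular_moment (real CARD('n)) (a \<bullet> a) d * moment k u (bump \<epsilon>) a 0 \<tau>"
        by (rule moment_proportional[OF that a \<epsilon>(1) \<gamma>])
      also have "moment k u (bump \<epsilon>) a 0 \<tau> = ?M u" by (simp add: moment_def)
      finally show ?thesis .
    qed
    have pow_cont: "continuous_on (half_sphere k) (\<lambda>y. (a \<bullet> y) ^ d)" by (intro continuous_intros)
    have "(LINT x:half_space k|lborel. ?D x * (a \<bullet> sgn x) ^ d)
        = (LINT x:half_space k|lborel. ?h u x * (a \<bullet> sgn x) ^ d - \<kappa> * (?h v x * (a \<bullet> sgn x) ^ d))"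
      by (rule set_lebesgue_integral_cong) (auto simp: algebra_simps)
    also have "\<dots> = (LINT x:half_space k|lborel. ?h u x * (a \<bullet> sgn x) ^ d)
        - \<kappa> * (LINT x:half_space k|lborel. ?h v x * (a \<bullet> sgn x) ^ d)"
      using set_integrable_mult_direction[OF h_int[OF u] pow_cont] set_integrable_mult_direction[OF h_int[OF v] pow_cont]
      by (subst set_integral_diff(2)) (auto intro: set_integrable_mult_right)
    also have "\<dots> = 0" unfolding eq[OF u] eq[OF v] using M by (simp add: \<kappa>_def)
    finally show "(LINT x:half_space k|lborel. ?D x * (a \<bullet> sgn x) ^ d) = 0" .
  qed
  moreover have "0 < (LINT x:half_space k|lborel. ?D x * ?f (sgn x))"
  proof (rule set_integral_pos)
    have D_eq: "?D x = (u x - \<kappa> * v x) * (x $ k / (x \<bullet> x) * exp (- (real CARD('n) / 2 * ln (norm x)))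
        * bump \<epsilon> (ln (norm x) - \<tau>))" for x
      by (simp only: moment_kernel_def divide_inverse left_diff_distrib mult.assoc)
    have gt: "u x - \<kappa> * v x > 0" if "0 < x $ k" "dist (sgn x) (sgn z) < \<delta>" "\<bar>ln (norm x) - \<tau>\<bar> < \<epsilon>" for x
    proof -
      have "\<kappa> * v x \<le> K * v x"
        using \<open>\<kappa> \<le> K\<close> hardy_solutionD(2)[OF v that(1)] by (simp add: mult_right_mono)
      also have "\<dots> < u x" using less[OF that(1,2)] that(3) \<epsilon> by (simp add: \<tau>_def)
      finally show ?thesis by simp
    qed
    show "set_integrable lborel (half_space k) (\<lambda>x. ?D x * ?f (sgn x))"
      by (rule set_integrable_mult_direction[OF D_int continuous_on_cone_bump])
    have "continuous_on (half_space k) (\<lambda>x. ?f (sgn x))"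
      by (auto intro!: continuous_intros dest: half_space_imp_nonzero)
    then show "continuous_on (half_space k) (\<lambda>x. ?D x * ?f (sgn x))"
      by (intro continuous_on_mult continuous_on_diff continuous_on_const h_cont u v)
    show "0 \<le> ?D x * ?f (sgn x)" if x: "0 < x $ k" for x
    proof (cases "dist (sgn x) (sgn z) < \<delta> \<and> \<bar>ln (norm x) - \<tau>\<bar> < \<epsilon>")
      case True
      then show ?thesis
        unfolding D_eq using gt[OF x] x bump_nonneg[of \<epsilon> "ln (norm x) - \<tau>"]
        by (intro mult_nonneg_nonneg) auto
    next
      case False
      then have "?f (sgn x) = 0 \<or> bump \<epsilon> (ln (norm x) - \<tau>) = 0"
        using bump_eq_0(1)[OF \<epsilon>(1), of "ln (norm x) - \<tau>"] by auto
      then show ?thesis by auto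
    qed
    show "0 < z $ k" by (rule z)
    have "z $ k / (z \<bullet> z) * exp (- (real CARD('n) / 2 * ln (norm z))) * bump \<epsilon> (ln (norm z) - \<tau>) > 0"
      using z half_space_imp_nonzero[OF z] bump_pos[OF \<epsilon>(1), of 0] \<epsilon>
      by (intro mult_pos_pos divide_pos_pos) (auto simp: \<tau>_def)
    moreover have "u z - \<kappa> * v z > 0" by (rule gt[OF z]) (use \<epsilon> in \<open>auto simp: \<tau>_def\<close>)
    ultimately have "?D z > 0"
      unfolding D_eq by (intro mult_pos_pos[of "u z - \<kappa> * v z"])
    then show "0 < ?D z * ?f (sgn z)" using \<epsilon> by simp
  qed
  ultimately show False by simp
qed

text \<open>
  Continuity at \<open>z\<close>, expressed in polar coordinates \<open>(ln |w|, sgn w)\<close>.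
\<close>

lemma polar_neighbourhood:
  fixes f :: "real ^ 'n::finite \<Rightarrow> real"
  assumes f: "continuous_on (half_space k) f" and z: "0 < z $ k" "0 < f z"
  obtains \<delta> where "\<delta> > 0"
    "\<And>w. 0 < w $ k \<Longrightarrow> dist (sgn w) (sgn z) < \<delta> \<Longrightarrow> \<bar>ln (norm w) - ln (norm z)\<bar> < \<delta> \<Longrightarrow> 0 < f w"
proof -
  let ?p = "\<lambda>q. exp (fst q) *\<^sub>R snd q :: real ^ 'n"
  have polar: "?p (ln (norm w), sgn w) = w" if "0 < w $ k" for w
    using half_space_imp_nonzero[OF that] by (simp add: sgn_div_norm)
  have "open (half_space k \<inter> f -` {0<..})"
    by (rule continuous_open_preimage[OF f open_half_space]) simp
  moreover have "continuous_on UNIV ?p" by (intro continuous_intros)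
  ultimately have "open (?p -` (half_space k \<inter> f -` {0<..}))"
    by (intro open_vimage) auto
  moreover have "(ln (norm z), sgn z) \<in> ?p -` (half_space k \<inter> f -` {0<..})"
    using polar[OF z(1)] z by simp
  ultimately obtain e where e: "e > 0" "ball (ln (norm z), sgn z) e \<subseteq> ?p -` (half_space k \<inter> f -` {0<..})"
    by (rule openE)
  show ?thesis
  proof (rule that[of "e / 2"])
    fix w assume w: "0 < w $ k" "dist (sgn w) (sgn z) < e / 2" "\<bar>ln (norm w) - ln (norm z)\<bar> < e / 2"
    have "dist (ln (norm z), sgn z) (ln (norm w), sgn w) \<le> dist (ln (norm z)) (ln (norm w)) + dist (sgn z) (sgn w)"
      by (simp add: dist_Pair_Pair sqrt_sum_squares_le_sum)
    then have "(ln (norm w), sgn w) \<in> ball (ln (norm z), sgn z) e"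
      using w by (simp add: dist_commute dist_real_def)
    then have "?p (ln (norm w), sgn w) \<in> half_space k \<inter> f -` {0<..}" using e(2) by blast
    then show "0 < f w" using polar[OF w(1)] by simp
  qed (use e in simp)
qed

text \<open>
  If the quotient at \<open>x\<close> and the one at \<open>y\<close> were separated by \<open>K\<close>, a thin annulus through both points
  would have a quotient of moments above \<open>K\<close> (seen near \<open>y\<close>) and below \<open>K\<close> (seen near \<open>x\<close>).
\<close>

lemma quotient_not_less:
  fixes k :: "'n::finite"
  assumes u: "hardy_solution k \<gamma> u" and v: "hardy_solution k \<gamma> v"
    and \<gamma>: "\<gamma> < (real CARD('n))\<^sup>2 / 4"
    and x: "0 < x $ k" and y: "0 < y $ k" and norm: "norm x = norm y"
  shows "\<not> u x / v x < u y / v y"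
proof
  assume "u x / v x < u y / v y"
  then obtain K where K: "u x / v x < K" "K < u y / v y" using dense by blast
  note ux = hardy_solutionD(2)[OF u x] and vx = hardy_solutionD(2)[OF v x]
    and vy = hardy_solutionD(2)[OF v y]
  have K0: "K > 0" using K(1) ux vx by (meson divide_pos_pos order.strict_trans)
  have cont: "continuous_on (half_space k) u" "continuous_on (half_space k) v"
    using hardy_solutionD(1)[OF u] hardy_solutionD(1)[OF v]
    by (auto elim!: continuous_on_subset dest: half_space_imp_nonzero)
  obtain \<delta>1 where \<delta>1: "\<delta>1 > 0"
    "\<And>w. 0 < w $ k \<Longrightarrow> dist (sgn w) (sgn y) < \<delta>1 \<Longrightarrow> \<bar>ln (norm w) - ln (norm y)\<bar> < \<delta>1 \<Longrightarrow> 0 < u w - K * v w"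
    by (rule polar_neighbourhood[of k "\<lambda>w. u w - K * v w" y])
       (use K(2) vy y in \<open>auto intro!: continuous_intros cont simp: less_divide_eq\<close>)
  obtain \<delta>2 where \<delta>2: "\<delta>2 > 0"
    "\<And>w. 0 < w $ k \<Longrightarrow> dist (sgn w) (sgn x) < \<delta>2 \<Longrightarrow> \<bar>ln (norm w) - ln (norm x)\<bar> < \<delta>2 \<Longrightarrow> 0 < v w - 1 / K * u w"
    by (rule polar_neighbourhood[of k "\<lambda>w. v w - 1 / K * u w" x])
       (use K(1) K0 vx x in \<open>auto intro!: continuous_intros cont simp: divide_less_eq mult.commute\<close>)
  define \<epsilon> where "\<epsilon> = min \<delta>1 \<delta>2"
  have \<epsilon>: "0 < \<epsilon>" "\<epsilon> \<le> \<delta>1" "\<epsilon> \<le> \<delta>2" using \<delta>1(1) \<delta>2(1) by (auto simp: \<epsilon>_def)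
  have "K * moment k v (bump \<epsilon>) 0 0 (ln (norm y)) < moment k u (bump \<epsilon>) 0 0 (ln (norm y))"
    by (rule moment_ratio_gt[OF u v \<gamma> y \<epsilon>(1,2)]) (use \<delta>1(2) in force)
  moreover have "1 / K * moment k u (bump \<epsilon>) 0 0 (ln (norm x)) < moment k v (bump \<epsilon>) 0 0 (ln (norm x))"
    by (rule moment_ratio_gt[OF v u \<gamma> x \<epsilon>(1,3)]) (use \<delta>2(2) in force)
  ultimately show False using K0 by (simp add: norm divide_less_eq mult.commute)
qed

section \<open>The radial equation\<close>

lemma hardy_solution_power:
  fixes k :: "'n::finite"
  assumes \<alpha>: "\<alpha>\<^sup>2 - real CARD('n) * \<alpha> + \<gamma> = 0"
  shows "hardy_solution k \<gamma> (sepfun k 0 0 (\<lambda>t. exp (- \<alpha> * t)))"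
proof -
  let ?g = "\<lambda>t. exp (- \<alpha> * t)" and ?g' = "\<lambda>t. - \<alpha> * exp (- \<alpha> * t)" and ?g'' = "\<lambda>t. \<alpha>\<^sup>2 * exp (- \<alpha> * t)"
  have deriv: "(?g has_real_derivative ?g' t) (at t)" "(?g' has_real_derivative ?g'' t) (at t)" for t
    by (rule derivative_eq_intros refl | simp add: power2_eq_square)+
  have cont: "continuous_on UNIV ?g" "continuous_on UNIV ?g'" "continuous_on UNIV ?g''"
    by (intro continuous_intros)+
  have "(\<Sum>i\<in>UNIV. sepfun2 k 0 0 ?g ?g' ?g'' i x) = - (\<gamma> / (x \<bullet> x) * sepfun k 0 0 ?g x)"
    if "0 < x $ k" for x
  proof -
    have "\<alpha>\<^sup>2 - real CARD('n) * \<alpha> = - \<gamma>" using \<alpha> by simp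
    have "(\<Sum>i\<in>UNIV. sepfun2 k 0 0 ?g ?g' ?g'' i x)
        = x $ k / (x \<bullet> x) * ((\<alpha>\<^sup>2 - real CARD('n) * \<alpha>) * exp (- \<alpha> * ln (norm x)))"
      by (simp add: sum_sepfun2[OF half_space_imp_nonzero[OF that]] algebra_simps)
    then show ?thesis
      unfolding \<open>\<alpha>\<^sup>2 - real CARD('n) * \<alpha> = - \<gamma>\<close> by (simp add: sepfun_def)
  qed
  then show ?thesis
    by (intro hardy_solutionI[where ?u1.0 = "sepfun1 k 0 0 ?g ?g'" and ?u2.0 = "sepfun2 k 0 0 ?g ?g' ?g''"]
        continuous_on_sepfun[OF cont] has_axis_deriv_sepfun has_axis_deriv_sepfun1 deriv)
       (auto simp: sepfun_def)
qed

lemma has_axis_deriv_unique: "has_axis_deriv f D i x \<Longrightarrow> has_axis_deriv f E i x \<Longrightarrow> D = E"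
  unfolding has_axis_deriv_def by (rule DERIV_unique)

text \<open>
  On the half-space \<open>u\<close> is \<open>sepfun k 0 0 g\<close>; differentiability of \<open>g\<close> is read off along the \<open>k\<close>-axis, where
  \<open>g t = u(exp(t) e\<^sub>k) / exp t\<close>.
\<close>

lemma radial_profile_equation:
  fixes k :: "'n::finite"
  assumes sol: "hardy_solution k \<gamma> u" and radial: "\<And>x. 0 < x $ k \<Longrightarrow> u x = x $ k * g (ln (norm x))"
  obtains g' g'' where "\<And>t. (g has_real_derivative g' t) (at t)" "\<And>t. (g' has_real_derivative g'' t) (at t)"
    "\<And>t. g'' t + real CARD('n) * g' t + \<gamma> * g t = 0"
proof -
  from sol obtain u1 u2 where u12:
      "\<forall>i x. 0 < x $ k \<longrightarrow> has_axis_deriv u (u1 i x) i x \<and> has_axis_deriv (u1 i) (u2 i x) i x"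
      "\<forall>x. 0 < x $ k \<longrightarrow> (\<Sum>i\<in>UNIV. u2 i x) = - (\<gamma> / (x \<bullet> x) * u x)"
    unfolding hardy_solution_def by (elim conjE exE) (rule that)
  let ?e = "\<lambda>s. s *\<^sub>R axis k (1::real)"
  define U U1 U2 where "U s = u (?e s)" and "U1 s = u1 k (?e s)" and "U2 s = u2 k (?e s)" for s
  have U: "(U has_real_derivative U1 s) (at s)" "(U1 has_real_derivative U2 s) (at s)" if "s > 0" for s
  proof -
    have pos: "0 < (0 + ?e s) $ k" using that by (simp add: axis_def)
    show "(U has_real_derivative U1 s) (at s)" "(U1 has_real_derivative U2 s) (at s)"
      using has_axis_deriv_along_line[of u "u1 k (?e s)" k 0 s] has_axis_deriv_along_line[of "u1 k" "u2 k (?e s)" k 0 s]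
        u12(1) pos by (simp_all add: U_def[abs_def] U1_def[abs_def] U2_def)
  qed
  have g_eq: "g t = U (exp t) * exp (- t)" for t
    using radial[of "?e (exp t)"] by (simp add: U_def axis_nth exp_minus)
  define g' where "g' t = U1 (exp t) - U (exp t) * exp (- t)" for t
  have UE: "((\<lambda>t. U (exp t)) has_real_derivative U1 (exp t) * exp t) (at t)"
    "((\<lambda>t. U1 (exp t)) has_real_derivative U2 (exp t) * exp t) (at t)" for t
    by (rule DERIV_chain2[OF U(1) DERIV_exp] DERIV_chain2[OF U(2) DERIV_exp]; simp)+
  have em: "((\<lambda>t. exp (- t)) has_real_derivative - exp (- t)) (at t)" for t :: real
    by (rule derivative_eq_intros refl | simp)+
  have UEm: "((\<lambda>t. U (exp t) * exp (- t)) has_real_derivative g' t) (at t)" for t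
    by (rule DERIV_cong[OF DERIV_mult[OF UE(1) em]]) (simp add: g'_def mult.assoc mult_exp_exp)
  have g: "(g has_real_derivative g' t) (at t)" for t
    using UEm[of t] g_eq by (simp add: ext[of g "\<lambda>t. U (exp t) * exp (- t)"])
  have g': "(g' has_real_derivative U2 (exp t) * exp t - g' t) (at t)" for t
    unfolding g'_def[abs_def] using DERIV_diff[OF UE(2) UEm, of t] by (simp add: g'_def[abs_def])
  let ?g'' = "\<lambda>t. U2 (exp t) * exp t - g' t"
  have sep_deriv: "has_axis_deriv (sepfun k 0 0 g) (sepfun1 k 0 0 g g' i x) i x"
    "has_axis_deriv (sepfun1 k 0 0 g g' i) (sepfun2 k 0 0 g g' ?g'' i x) i x" if "0 < x $ k" for i x
    by (intro has_axis_deriv_sepfun has_axis_deriv_sepfun1 half_space_imp_nonzero[OF that] g g')+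
  have sep: "sepfun k 0 0 g x = u x" if "0 < x $ k" for x
    using radial[OF that] by (simp add: sepfun_def)
  have u1: "u1 i x = sepfun1 k 0 0 g g' i x" if "0 < x $ k" for i x
  proof (rule has_axis_deriv_unique)
    show "has_axis_deriv u (u1 i x) i x" using u12(1) that by blast
    show "has_axis_deriv u (sepfun1 k 0 0 g g' i x) i x"
      by (rule has_axis_deriv_cong_open[OF sep_deriv(1)[OF that] open_half_space])
         (use that sep in auto)
  qed
  have u2: "u2 i x = sepfun2 k 0 0 g g' ?g'' i x" if "0 < x $ k" for i x
  proof (rule has_axis_deriv_unique)
    show "has_axis_deriv (u1 i) (u2 i x) i x" using u12(1) that by blast
    show "has_axis_deriv (u1 i) (sepfun2 k 0 0 g g' ?g'' i x) i x"
      by (rule has_axis_deriv_cong_open[OF sep_deriv(2)[OF that] open_half_space])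
         (use that u1 in auto)
  qed
  show ?thesis
  proof (rule that[OF g g'])
    fix t
    let ?x = "?e (exp t)"
    have x: "0 < ?x $ k" "norm ?x = exp t" by (simp_all add: axis_nth)
    have "?x $ k / (?x \<bullet> ?x) * (?g'' t + real CARD('n) * g' t) = (\<Sum>i\<in>UNIV. u2 i ?x)"
      using sum_sepfun2[OF half_space_imp_nonzero[OF x(1)], of 0 k 0 g g' ?g''] x u2[OF x(1)] by simp
    also have "\<dots> = - (\<gamma> / (?x \<bullet> ?x) * (?x $ k * g t))"
      using u12(2) x radial[OF x(1)] by simp
    finally have "?x $ k / (?x \<bullet> ?x) * (?g'' t + real CARD('n) * g' t + \<gamma> * g t) = 0"
      by (simp add: distrib_left mult_ac)
    then show "?g'' t + real CARD('n) * g' t + \<gamma> * g t = 0"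
      using x(1) half_space_imp_nonzero[OF x(1)] by (simp del: scaleR_eq_0_iff inner_scaleR_left inner_scaleR_right vector_scaleR_component)
  qed
qed

section \<open>Classification of the solutions\<close>

text \<open>
  Comparison with the explicit solution \<open>x\<^sub>k |x| powr (- \<alpha>)\<close>, \<open>\<alpha> = alpha_plus CARD('n) \<gamma>\<close>, shows that \<open>u / x\<^sub>k\<close> is a function
  of \<open>|x|\<close>. Multiplied by \<open>|x| powr (n / 2)\<close>, it solves \<open>f'' = b\<^sup>2 f\<close> in the variable \<open>ln |x|\<close>.
\<close>

lemma hardy_solution_classification:
  fixes k :: "'n::finite"
  assumes sol: "hardy_solution k \<gamma> u" and \<gamma>: "\<gamma> < (real CARD('n))\<^sup>2 / 4"
  obtains A B where "A \<ge> 0" "B \<ge> 0"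
    "\<And>x. 0 < x $ k \<Longrightarrow> u x = A * x $ k * norm x powr (- alpha_minus CARD('n) \<gamma>)
        + B * x $ k * norm x powr (- alpha_plus CARD('n) \<gamma>)"
proof -
  let ?n = "real CARD('n)"
  define b where "b = sqrt (?n\<^sup>2 / 4 - \<gamma>)"
  have b: "b > 0" "b\<^sup>2 = ?n\<^sup>2 / 4 - \<gamma>" using \<gamma> by (simp_all add: b_def)
  define \<alpha> where "\<alpha> = ?n / 2 + b"
  have "\<alpha>\<^sup>2 - ?n * \<alpha> + \<gamma> = b\<^sup>2 - ?n\<^sup>2 / 4 + \<gamma>"
    by (simp add: \<alpha>_def power2_eq_square algebra_simps)
  then have root: "\<alpha>\<^sup>2 - ?n * \<alpha> + \<gamma> = 0" using b by simp
  define v where "v = sepfun k 0 0 (\<lambda>t. exp (- \<alpha> * t))"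
  have v: "hardy_solution k \<gamma> v"
    unfolding v_def by (rule hardy_solution_power[OF root])
  define g where "g t = u (exp t *\<^sub>R axis k 1) / exp t" for t
  have radial: "u x = x $ k * g (ln (norm x))" if x: "0 < x $ k" for x
  proof -
    let ?y = "norm x *\<^sub>R axis k (1::real)"
    have nx: "norm x > 0" using half_space_imp_nonzero[OF x] by simp
    then have y: "0 < ?y $ k" by (simp add: axis_def)
    have "norm x = norm ?y" by simp
    from quotient_not_less[OF sol v \<gamma> x y this] quotient_not_less[OF sol v \<gamma> y x this[symmetric]]
    have "u x / v x = u ?y / v ?y" by linarith
    moreover have "v x = x $ k * exp (- \<alpha> * ln (norm x))" "v ?y = norm x * exp (- \<alpha> * ln (norm x))"
      by (simp_all add: v_def sepfun_def axis_nth)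
    ultimately show ?thesis
      using x nx by (simp add: g_def field_simps)
  qed
  obtain g' g'' where g: "\<And>t. (g has_real_derivative g' t) (at t)" "\<And>t. (g' has_real_derivative g'' t) (at t)"
    "\<And>t. g'' t + ?n * g' t + \<gamma> * g t = 0"
    using radial_profile_equation[OF sol radial] by blast
  let ?E = "\<lambda>t. exp (?n / 2 * t)"
  obtain A B where AB: "\<And>t. ?E t * g t = A * exp (b * t) + B * exp (- b * t)"
  proof (rule exponential_solutions[OF b(1)])
    have E: "(?E has_real_derivative ?E t * (?n / 2)) (at t)" for t
      by (rule derivative_eq_intros refl | simp)+
    show "((\<lambda>t. ?E t * g t) has_real_derivative ?E t * (g' t + ?n / 2 * g t)) (at t)" for t
      using DERIV_mult[OF E g(1)] by (simp add: algebra_simps)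
    show "((\<lambda>t. ?E t * (g' t + ?n / 2 * g t)) has_real_derivative
        ?E t * (g'' t + ?n * g' t + ?n\<^sup>2 / 4 * g t)) (at t)" for t
      by (rule DERIV_cong[OF DERIV_mult[OF E DERIV_add[OF g(2) DERIV_cmult[OF g(1), of "?n / 2"]]]])
         (simp add: field_simps power2_eq_square)
    show "?E t * (g'' t + ?n * g' t + ?n\<^sup>2 / 4 * g t) = b\<^sup>2 * (?E t * g t)" for t
    proof -
      have "g'' t + ?n * g' t = - (\<gamma> * g t)" using g(3)[of t] by simp
      then show ?thesis unfolding b(2) by (simp add: algebra_simps)
    qed
  qed (rule that)
  have "0 \<le> A * exp (b * t) + B * exp (- b * t)" for t
  proof -
    have "0 < (exp t *\<^sub>R axis k (1::real)) $ k" by (simp add: axis_def)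
    from hardy_solutionD(2)[OF sol this] have "g t > 0" by (simp add: g_def)
    then show ?thesis unfolding AB[symmetric] by simp
  qed
  note nonneg = nonneg_exponentials[OF b(1) this]
  show ?thesis
  proof (rule that[OF nonneg])
    fix x :: "real ^ 'n" assume x: "0 < x $ k"
    let ?t = "ln (norm x)"
    have "g ?t = exp (- (?n / 2 * ?t)) * (?E ?t * g ?t)"
      by (simp add: mult_exp_exp flip: mult.assoc)
    also have "\<dots> = A * exp ((b - ?n / 2) * ?t) + B * exp (- (b + ?n / 2) * ?t)"
      unfolding AB by (simp add: distrib_left mult_exp_exp mult.left_commute[of "exp _"]) (simp add: algebra_simps)
    also have "\<dots> = A * norm x powr (- alpha_minus CARD('n) \<gamma>) + B * norm x powr (- alpha_plus CARD('n) \<gamma>)"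
      using half_space_imp_nonzero[OF x]
      by (simp add: powr_def alpha_minus_def alpha_plus_def b_def[symmetric] add.commute)
    finally show "u x = A * x $ k * norm x powr (- alpha_minus CARD('n) \<gamma>)
        + B * x $ k * norm x powr (- alpha_plus CARD('n) \<gamma>)"
      unfolding radial[OF x] by (simp add: algebra_simps)
  qed
qed

lemma frontier_half_space: "frontier (half_space k) = {x. x $ k = 0}"
  unfolding frontier_def interior_open[OF open_half_space]
  unfolding half_space_def by (auto simp: closure_halfspace_component_gt)

text \<open>
  The iterated \<open>partial_deriv\<close> in the Laplacian is taken of \<open>partial_deriv i u\<close>, while the second derivatives
  in \<open>Ck_up_to\<close> are those of an extension \<open>u1 i\<close> of it; the two agree since the half-space is open.
\<close>

lemma hardy_solution_of_C2:
  fixes u :: "real ^ 'n::finite \<Rightarrow> real"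
  assumes C2: "Ck_up_to 2 (half_space k) (closure (half_space k) - {0}) u"
    and eq: "\<And>x. x \<in> half_space k \<Longrightarrow> - laplacian u x - \<gamma> / (norm x)\<^sup>2 * u x = 0"
    and pos: "\<And>x. x \<in> half_space k \<Longrightarrow> u x > 0"
    and bdry: "\<And>x. x \<in> frontier (half_space k) - {0} \<Longrightarrow> u x = 0"
  shows "hardy_solution k \<gamma> u"
proof -
  have deriv: "has_axis_deriv f (partial_deriv i f x) i x"
    if "(\<lambda>t. f (x + t *\<^sub>R axis i 1)) field_differentiable at 0" for f :: "real ^ 'n \<Rightarrow> real" and i x
    using that unfolding has_axis_deriv_def partial_deriv_def by (simp add: DERIV_deriv_iff_field_differentiable)
  have cont: "continuous_on (punctured k) u"
    and ex1: "\<forall>i. \<exists>g. Ck_up_to 1 (half_space k) (punctured k) g \<and> (\<forall>x\<in>half_space k. g x = partial_deriv i u x)"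
    and d1: "\<And>i x. x \<in> half_space k \<Longrightarrow> (\<lambda>t. u (x + t *\<^sub>R axis i 1)) field_differentiable at 0"
    using C2 unfolding closure_half_space_minus_origin by (auto simp: numeral_2_eq_2)
  from choice[OF ex1] obtain u1 where u1: "\<And>i. Ck_up_to 1 (half_space k) (punctured k) (u1 i)"
    "\<And>i x. x \<in> half_space k \<Longrightarrow> u1 i x = partial_deriv i u x" by blast
  have ex2: "\<forall>i. \<exists>g. continuous_on (punctured k) g \<and> (\<forall>x\<in>half_space k. g x = partial_deriv i (u1 i) x)"
    and u1_cont: "\<And>i. continuous_on (punctured k) (u1 i)"
    and d2: "\<And>i x. x \<in> half_space k \<Longrightarrow> (\<lambda>t. u1 i (x + t *\<^sub>R axis i 1)) field_differentiable at 0"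
    using u1(1) by auto
  from choice[OF ex2] obtain u2 where u2: "\<And>i. continuous_on (punctured k) (u2 i)"
    "\<And>i x. x \<in> half_space k \<Longrightarrow> u2 i x = partial_deriv i (u1 i) x" by blast
  have D1: "has_axis_deriv u (u1 i x) i x" if "0 < x $ k" for i x
    using deriv[OF d1, of x i] u1(2)[of x i] that by simp
  have D2: "has_axis_deriv (u1 i) (u2 i x) i x" if "0 < x $ k" for i x
    using deriv[OF d2, of x i] u2(2)[of x i] that by simp
  have "(\<Sum>i\<in>UNIV. u2 i x) = - (\<gamma> / (x \<bullet> x) * u x)" if x: "0 < x $ k" for x
  proof -
    have "partial_deriv i (partial_deriv i u) x = u2 i x" for i
      by (rule partial_deriv_eq, rule has_axis_deriv_cong_open[OF D2[OF x] open_half_space[of k]])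
         (use x u1(2) in auto)
    then have "laplacian u x = (\<Sum>i\<in>UNIV. u2 i x)" by (simp add: laplacian_def)
    then show ?thesis using eq[of x] x by (simp add: dot_square_norm)
  qed
  moreover have "u x = 0" if "x $ k = 0" "x \<noteq> 0" for x
    using bdry[of x] that by (simp add: frontier_half_space)
  ultimately show ?thesis
    using cont pos u1_cont u2(1) D1 D2 by (intro hardy_solutionI[where ?u1.0 = u1 and ?u2.0 = u2]) auto
qed

theorem proposition1p6:
  fixes u :: "real ^ 'n::finite \<Rightarrow> real" and \<gamma> :: real and k :: 'n
  assumes "CARD('n) \<ge> 3"
    and "\<gamma> < (real CARD('n))\<^sup>2 / 4"
    and "Ck_up_to 2 (half_space k) (closure (half_space k) - {0}) u"
    and "\<And>x. x \<in> half_space k \<Longrightarrow> - laplacian u x - \<gamma> / (norm x)\<^sup>2 * u x = 0"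
    and "\<And>x. x \<in> half_space k \<Longrightarrow> u x > 0"
    and "\<And>x. x \<in> frontier (half_space k) - {0} \<Longrightarrow> u x = 0"
  shows "\<exists>c\<^sub>m c\<^sub>p. c\<^sub>m \<ge> 0 \<and> c\<^sub>p \<ge> 0 \<and>
    (\<forall>x\<in>half_space k.
      u x = c\<^sub>m * x $ k * norm x powr (- alpha_minus CARD('n) \<gamma>)
          + c\<^sub>p * x $ k * norm x powr (- alpha_plus CARD('n) \<gamma>))"
proof -
  have "hardy_solution k \<gamma> u"
    by (rule hardy_solution_of_C2) fact+
  then obtain A B where "A \<ge> 0" "B \<ge> 0"
    "\<And>x. 0 < x $ k \<Longrightarrow> u x = A * x $ k * norm x powr (- alpha_minus CARD('n) \<gamma>)
        + B * x $ k * norm x powr (- alpha_plus CARD('n) \<gamma>)"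
    using hardy_solution_classification assms(2) by blast
  then show ?thesis by (intro exI[of _ A] exI[of _ B]) auto
qed

end
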